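(* Let $\mathbb K$ be a unital commutative associative ring containing $\frac16$ and let $P=P_0\oplus P_1$ be an SP-graded Kantor pair over $\mathbb K$. Then there exists a unique $\mathrm{BC}_2$-grading of the Lie algebra $\mathfrak K(P)$ (called the standard $\mathrm{BC}_2$-grading) such that $\mathfrak K(P)_{\sigma1,\sigma i}=P_i^\sigma$ for $\sigma=\pm$ and $i\in\mathbb Z$. Moreover, for $\sigma=\pm$, $$\mathfrak K(P)_{\sigma2,\sigma2i}=[P_i^\sigma,P_i^\sigma]\ (i=0,1),\qquad \mathfrak K(P)_{\sigma2,\sigma1}=[P_0^\sigma,P_1^\sigma],$$ $$\mathfrak K(P)_{0,\sigma1}=[P_1^\sigma,P_0^{-\sigma}],\qquad \mathfrak K(P)_{0,0}=\sum_{j=0,1}[P_j^\sigma,P_j^{-\sigma}].$$ Finally, the first component grading of the standard $\mathrm{BC}_2$-grading is the standard $5$-grading of $\mathfrak K(P)$, and $\mathfrak K(P)$ with the standard $\mathrm{BC}_2$-grading tightly envelops the SP-graded Kantor pair $P$.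
   Context: All modules and algebras are over $\mathbb K$; $\sigma=\pm$ (also read as $\pm1$). Kantor pairs. A trilinear pair is a pair $P=(P^-,P^+)$ of modules with trilinear maps $\{\,,\,,\,\}:P^\sigma\times P^{-\sigma}\times P^\sigma\to P^\sigma$, $\sigma=\pm$. Put $D(x^\sigma,y^{-\sigma})z^\sigma=\{x^\sigma,y^{-\sigma},z^\sigma\}$ and $K(x^\sigma,z^\sigma)y^{-\sigma}=\{x^\sigma,y^{-\sigma},z^\sigma\}-\{z^\sigma,y^{-\sigma},x^\sigma\}$. $P$ is a Kantor pair if for all $x^\sigma,z^\sigma,u^\sigma\in P^\sigma$, $y^{-\sigma},w^{-\sigma}\in P^{-\sigma}$, $\sigma=\pm$: (K1) $[D(x^\sigma,y^{-\sigma}),D(z^\sigma,w^{-\sigma})]=D(D(x^\sigma,y^{-\sigma})z^\sigma,w^{-\sigma})-D(z^\sigma,D(y^{-\sigma},x^\sigma)w^{-\sigma})$; (K2) $K(x^\sigma,z^\sigma)D(w^{-\sigma},u^\sigma)+D(u^\sigma,w^{-\sigma})K(x^\sigma,z^\sigma)=K(K(x^\sigma,z^\sigma)w^{-\sigma},u^\sigma)$. SP-gradings. An SP-grading of $P$ is a pair of decompositions $P^\sigma=P_0^\sigma\oplus P_1^\sigma$ (with $P_i^\sigma=0$ for $i\ne0,1$) such that $\{P_i^\sigma,P_j^{-\sigma},P_k^\sigma\}\subseteq P^\sigma_{i-j+k}$ for all $i,j,k\in\mathbb Z$, $\sigma=\pm$; $P$ with it is an SP-graded Kantor pair. $\mathrm{BC}_2$-gradings.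 A $\mathrm{BC}_2$-graded Lie algebra is a $\mathbb Z^2$-graded Lie algebra $L=\bigoplus L_{i,j}$ with support contained in $\Delta\cup\{0\}$, $\Delta=\{\pm(1,0),\pm(0,1),\pm(1,1),\pm(2,0),\pm(2,1),\pm(2,2)\}$ (coordinates with respect to a base $\{\alpha_1,\alpha_2\}$, $\alpha_1$ short, of the root system of type $\mathrm{BC}_2$). Its first component grading is the $\mathbb Z$-grading $L=\bigoplus_iL_{i,*}$, $L_{i,*}=\bigoplus_jL_{i,j}$, which is a $5$-grading (zero outside degrees $-2,\dots,2$). $L$ envelops the SP-graded Kantor pair $P$ if $P^\sigma=L_{\sigma1,*}$ with products $\{x^\sigma,y^{-\sigma},z^\sigma\}=[[x^\sigma,y^{-\sigma}],z^\sigma]$ and $P_i^\sigma=L_{\sigma1,\sigma i}$. Put $T_L(P)=P^-\oplus P^+\subseteq L$. $L$ tightly envelops $P$ if in addition $T_L(P)$ generates $L$ as an algebra and $Z(L)\cap[T_L(P),T_L(P)]=0$, $Z(L)$ the centre. Kantor Lie algebra. Identify $\mathrm{End}(P^-\oplus P^+)$ with $2\times2$ matrices of homomorphisms acting on column vectors $\begin{bmatrix} P^- \\ P^+ \end{bmatrix}$. Let $\mathfrak S(P)$ be the span of all $\begin{bmatrix} D(x^-,x^+) & K(y^-,z^-) \\ K(y^+,z^+) & -D(x^+,x^-) \end{bmatrix}$, $x^\sigma,y^\sigma,z^\sigma\in P^\sigma$. $\mathfrak K(P)=\mathfrak S(P)\oplus\begin{bmatrix} P^- \\ P^+ \end{bmatrix}$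 is the Lie algebra with $[A,B]=AB-BA$, $[A,v]=Av$ for $A,B\in\mathfrak S(P)$ and column vectors $v$, and $\left[\begin{bmatrix} x^- \\ x^+ \end{bmatrix},\begin{bmatrix} y^- \\ y^+ \end{bmatrix}\right]=\begin{bmatrix} D(x^-,y^+)-D(y^-,x^+) & K(x^-,y^-) \\ K(x^+,y^+) & -D(y^+,x^-)+D(x^+,y^-) \end{bmatrix}$. Its standard $5$-grading has $\mathfrak K(P)_{-1}=\begin{bmatrix} P^- \\ 0 \end{bmatrix}$, $\mathfrak K(P)_1=\begin{bmatrix} 0 \\ P^+ \end{bmatrix}$, $\mathfrak K(P)_{-2}$ (resp. $\mathfrak K(P)_2$) the strictly upper (resp. strictly lower) triangular part of $\mathfrak S(P)$, and $\mathfrak K(P)_0$ the span of the matrices $\mathrm{diag}(D(x^-,x^+),-D(x^+,x^-))$. $P^\pm$ is identified with $\mathfrak K(P)_{\pm1}$. *)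

theory Defs
  imports "HOL-Analysis.Product_Vector" "HOL-Library.Function_Algebras"
begin

section \<open>Submodules\<close>

text \<open>The submodule \<open>L\<close> is the internal direct sum of the submodules \<open>A i\<close>, where \<open>i\<close> runs over
  the whole (possibly infinite) index type.\<close>

definition internal_direct_sum ::
    "('k::comm_ring_1 \<Rightarrow> 'l::ab_group_add \<Rightarrow> 'l) \<Rightarrow> 'l set \<Rightarrow> ('i \<Rightarrow> 'l set) \<Rightarrow> bool" where
  "internal_direct_sum s L A \<longleftrightarrow>
     module.subspace s L \<and>
     (\<forall>i. module.subspace s (A i) \<and> A i \<subseteq> L) \<and>
     (\<forall>x\<in>L. \<exists>!f. (\<forall>i. f i \<in> A i) \<and> finite {i. f i \<noteq> 0} \<and> x = (\<Sum>i | f i \<noteq> 0. f i))"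

definition submodule_sum ::
    "('k::comm_ring_1 \<Rightarrow> 'l::ab_group_add \<Rightarrow> 'l) \<Rightarrow> 'i set \<Rightarrow> ('i \<Rightarrow> 'l set) \<Rightarrow> 'l set" where
  "submodule_sum s I A = module.span s (\<Union>i\<in>I. A i)"

definition fun_scale :: "('k \<Rightarrow> 'b \<Rightarrow> 'b) \<Rightarrow> 'k \<Rightarrow> ('a \<Rightarrow> 'b) \<Rightarrow> 'a \<Rightarrow> 'b" where
  "fun_scale s c f = (\<lambda>x. s c (f x))"


section \<open>Kantor pairs and SP-gradings\<close>

text \<open>A trilinear pair consists of modules \<open>P\<^sup>-\<close>, \<open>P\<^sup>+\<close>, given by the types \<open>'m\<close>, \<open>'p\<close> with scalar
  multiplications \<open>sm\<close>, \<open>sp\<close>, and of products \<open>tm\<close> (for \<open>\<sigma> = -\<close>) and \<open>tp\<close> (for \<open>\<sigma> = +\<close>).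
  The notions below are stated for one sign: there \<open>t\<close> is the product on \<open>P\<^sup>\<sigma>\<close>, and \<open>t'\<close>
  the one on \<open>P\<^sup>-\<^sup>\<sigma>\<close>.\<close>

definition trilinear ::
    "('k::comm_ring_1 \<Rightarrow> 'a::ab_group_add \<Rightarrow> 'a) \<Rightarrow> ('k \<Rightarrow> 'b::ab_group_add \<Rightarrow> 'b) \<Rightarrow>
     ('a \<Rightarrow> 'b \<Rightarrow> 'a \<Rightarrow> 'a) \<Rightarrow> bool" where
  "trilinear s s' t \<longleftrightarrow>
     (\<forall>y z. module_hom s s (\<lambda>x. t x y z)) \<and>
     (\<forall>x z. module_hom s' s (\<lambda>y. t x y z)) \<and>
     (\<forall>x y. module_hom s s (\<lambda>z. t x y z))"

definition kp_D :: "('a \<Rightarrow> 'b \<Rightarrow> 'a \<Rightarrow> 'a) \<Rightarrow> 'a \<Rightarrow> 'b \<Rightarrow> 'a \<Rightarrow> 'a" where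
  "kp_D t x y = (\<lambda>z. t x y z)"

definition kp_K :: "('a::ab_group_add \<Rightarrow> 'b \<Rightarrow> 'a \<Rightarrow> 'a) \<Rightarrow> 'a \<Rightarrow> 'a \<Rightarrow> 'b \<Rightarrow> 'a" where
  "kp_K t x z = (\<lambda>y. t x y z - t z y x)"

definition kantor_identity_1 ::
    "('a::ab_group_add \<Rightarrow> 'b::ab_group_add \<Rightarrow> 'a \<Rightarrow> 'a) \<Rightarrow> ('b \<Rightarrow> 'a \<Rightarrow> 'b \<Rightarrow> 'b) \<Rightarrow> bool" where
  "kantor_identity_1 t t' \<longleftrightarrow> (\<forall>x z y w.
     (kp_D t x y \<circ> kp_D t z w) - (kp_D t z w \<circ> kp_D t x y) =
     kp_D t (kp_D t x y z) w - kp_D t z (kp_D t' y x w))"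

definition kantor_identity_2 ::
    "('a::ab_group_add \<Rightarrow> 'b::ab_group_add \<Rightarrow> 'a \<Rightarrow> 'a) \<Rightarrow> ('b \<Rightarrow> 'a \<Rightarrow> 'b \<Rightarrow> 'b) \<Rightarrow> bool" where
  "kantor_identity_2 t t' \<longleftrightarrow> (\<forall>x z u w.
     (kp_K t x z \<circ> kp_D t' w u) + (kp_D t u w \<circ> kp_K t x z) = kp_K t (kp_K t x z w) u)"

locale kantor_pair = neg: module sm + pos: module sp
  for sm :: "'k::comm_ring_1 \<Rightarrow> 'm::ab_group_add \<Rightarrow> 'm"
    and sp :: "'k \<Rightarrow> 'p::ab_group_add \<Rightarrow> 'p" +
  fixes tm :: "'m \<Rightarrow> 'p \<Rightarrow> 'm \<Rightarrow> 'm"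
    and tp :: "'p \<Rightarrow> 'm \<Rightarrow> 'p \<Rightarrow> 'p"
  assumes trilinear_neg: "trilinear sm sp tm"
    and trilinear_pos: "trilinear sp sm tp"
    and K1_neg: "kantor_identity_1 tm tp"
    and K1_pos: "kantor_identity_1 tp tm"
    and K2_neg: "kantor_identity_2 tm tp"
    and K2_pos: "kantor_identity_2 tp tm"

locale SP_graded_kantor_pair = kantor_pair sm sp tm tp
  for sm :: "'k::comm_ring_1 \<Rightarrow> 'm::ab_group_add \<Rightarrow> 'm"
    and sp :: "'k \<Rightarrow> 'p::ab_group_add \<Rightarrow> 'p"
    and tm :: "'m \<Rightarrow> 'p \<Rightarrow> 'm \<Rightarrow> 'm"
    and tp :: "'p \<Rightarrow> 'm \<Rightarrow> 'p \<Rightarrow> 'p" +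
  fixes Pm :: "int \<Rightarrow> 'm set"
    and Pp :: "int \<Rightarrow> 'p set"
  assumes direct_sum_neg: "internal_direct_sum sm UNIV Pm"
    and direct_sum_pos: "internal_direct_sum sp UNIV Pp"
    and support_neg: "i \<notin> {0, 1} \<Longrightarrow> Pm i = {0}"
    and support_pos: "i \<notin> {0, 1} \<Longrightarrow> Pp i = {0}"
    and graded_neg: "x \<in> Pm i \<Longrightarrow> y \<in> Pp j \<Longrightarrow> z \<in> Pm k \<Longrightarrow> tm x y z \<in> Pm (i - j + k)"
    and graded_pos: "u \<in> Pp i \<Longrightarrow> v \<in> Pm j \<Longrightarrow> w \<in> Pp k \<Longrightarrow> tp u v w \<in> Pp (i - j + k)"


section \<open>Lie algebras and \<open>BC\<^sub>2\<close>-gradings\<close>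

text \<open>A Lie algebra is carried by a submodule \<open>L\<close> of a type; the values of \<open>br\<close> outside \<open>L\<close> are
  irrelevant.\<close>

locale lie_algebra = module s
  for s :: "'k::comm_ring_1 \<Rightarrow> 'l::ab_group_add \<Rightarrow> 'l" +
  fixes L :: "'l set"
    and br :: "'l \<Rightarrow> 'l \<Rightarrow> 'l"
  assumes subspace_L: "subspace L"
    and br_closed: "x \<in> L \<Longrightarrow> y \<in> L \<Longrightarrow> br x y \<in> L"
    and br_add_left: "x \<in> L \<Longrightarrow> y \<in> L \<Longrightarrow> z \<in> L \<Longrightarrow> br (x + y) z = br x z + br y z"
    and br_add_right: "x \<in> L \<Longrightarrow> y \<in> L \<Longrightarrow> z \<in> L \<Longrightarrow> br x (y + z) = br x y + br x z"
    and br_scale_left: "x \<in> L \<Longrightarrow> y \<in> L \<Longrightarrow> br (s c x) y = s c (br x y)"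
    and br_scale_right: "x \<in> L \<Longrightarrow> y \<in> L \<Longrightarrow> br x (s c y) = s c (br x y)"
    and br_alternating: "x \<in> L \<Longrightarrow> br x x = 0"
    and jacobi: "x \<in> L \<Longrightarrow> y \<in> L \<Longrightarrow> z \<in> L \<Longrightarrow>
      br (br x y) z + br (br y z) x + br (br z x) y = 0"

text \<open>For sets \<open>X\<close>, \<open>Y\<close> the notation \<open>[X, Y]\<close> means the span of all brackets.\<close>

definition bracket_span ::
    "('k::comm_ring_1 \<Rightarrow> 'l::ab_group_add \<Rightarrow> 'l) \<Rightarrow> ('l \<Rightarrow> 'l \<Rightarrow> 'l) \<Rightarrow> 'l set \<Rightarrow> 'l set \<Rightarrow> 'l set" where
  "bracket_span s br X Y = module.span s {br x y | x y. x \<in> X \<and> y \<in> Y}"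

definition lie_center :: "'l::zero set \<Rightarrow> ('l \<Rightarrow> 'l \<Rightarrow> 'l) \<Rightarrow> 'l set" where
  "lie_center L br = {z \<in> L. \<forall>x\<in>L. br z x = 0}"

definition lie_subalgebra ::
    "('k::comm_ring_1 \<Rightarrow> 'l::ab_group_add \<Rightarrow> 'l) \<Rightarrow> 'l set \<Rightarrow> ('l \<Rightarrow> 'l \<Rightarrow> 'l) \<Rightarrow> 'l set \<Rightarrow> bool" where
  "lie_subalgebra s L br B \<longleftrightarrow>
     module.subspace s B \<and> B \<subseteq> L \<and> (\<forall>x\<in>B. \<forall>y\<in>B. br x y \<in> B)"

definition BC2_roots :: "(int \<times> int) set" where
  "BC2_roots = {(1,0), (0,1), (1,1), (2,0), (2,1), (2,2),
                (-1,0), (0,-1), (-1,-1), (-2,0), (-2,-1), (-2,-2)}"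

locale BC2_graded_lie_algebra = lie_algebra s L br
  for s :: "'k::comm_ring_1 \<Rightarrow> 'l::ab_group_add \<Rightarrow> 'l"
    and L :: "'l set"
    and br :: "'l \<Rightarrow> 'l \<Rightarrow> 'l" +
  fixes G :: "int \<Rightarrow> int \<Rightarrow> 'l set"
  assumes direct_sum: "internal_direct_sum s L (\<lambda>(i, j). G i j)"
    and br_graded: "x \<in> G i j \<Longrightarrow> y \<in> G k l \<Longrightarrow> br x y \<in> G (i + k) (j + l)"
    and support: "(i, j) \<notin> BC2_roots \<union> {(0, 0)} \<Longrightarrow> G i j = {0}"

definition first_component_grading ::
    "('k::comm_ring_1 \<Rightarrow> 'l::ab_group_add \<Rightarrow> 'l) \<Rightarrow> (int \<Rightarrow> int \<Rightarrow> 'l set) \<Rightarrow> int \<Rightarrow> 'l set" where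
  "first_component_grading s G i = submodule_sum s UNIV (\<lambda>j. G i j)"

text \<open>The identifications of \<open>P\<^sup>-\<close> and \<open>P\<^sup>+\<close> with the components of degree \<open>-1\<close> and \<open>1\<close> are made
  explicit as embeddings \<open>em\<close> and \<open>ep\<close>.\<close>

locale envelops_SP_graded_kantor_pair =
  BC2_graded_lie_algebra s L br G + SP_graded_kantor_pair sm sp tm tp Pm Pp
  for s :: "'k::comm_ring_1 \<Rightarrow> 'l::ab_group_add \<Rightarrow> 'l"
    and L :: "'l set"
    and br :: "'l \<Rightarrow> 'l \<Rightarrow> 'l"
    and G :: "int \<Rightarrow> int \<Rightarrow> 'l set"
    and sm :: "'k \<Rightarrow> 'm::ab_group_add \<Rightarrow> 'm"
    and sp :: "'k \<Rightarrow> 'p::ab_group_add \<Rightarrow> 'p"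
    and tm :: "'m \<Rightarrow> 'p \<Rightarrow> 'm \<Rightarrow> 'm"
    and tp :: "'p \<Rightarrow> 'm \<Rightarrow> 'p \<Rightarrow> 'p"
    and Pm :: "int \<Rightarrow> 'm set"
    and Pp :: "int \<Rightarrow> 'p set" +
  fixes em :: "'m \<Rightarrow> 'l"
    and ep :: "'p \<Rightarrow> 'l"
  assumes hom_em: "module_hom sm s em" and inj_em: "inj em"
    and hom_ep: "module_hom sp s ep" and inj_ep: "inj ep"
    and range_em: "range em = first_component_grading s G (-1)"
    and range_ep: "range ep = first_component_grading s G 1"
    and em_product: "em (tm x y x') = br (br (em x) (ep y)) (em x')"
    and ep_product: "ep (tp y x y') = br (br (ep y) (em x)) (ep y')"
    and em_component: "em ` Pm i = G (-1) (-i)"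
    and ep_component: "ep ` Pp i = G 1 i"

locale tightly_envelops_SP_graded_kantor_pair =
  envelops_SP_graded_kantor_pair s L br G sm sp tm tp Pm Pp em ep
  for s :: "'k::comm_ring_1 \<Rightarrow> 'l::ab_group_add \<Rightarrow> 'l"
    and L :: "'l set"
    and br :: "'l \<Rightarrow> 'l \<Rightarrow> 'l"
    and G :: "int \<Rightarrow> int \<Rightarrow> 'l set"
    and sm :: "'k \<Rightarrow> 'm::ab_group_add \<Rightarrow> 'm"
    and sp :: "'k \<Rightarrow> 'p::ab_group_add \<Rightarrow> 'p"
    and tm :: "'m \<Rightarrow> 'p \<Rightarrow> 'm \<Rightarrow> 'm"
    and tp :: "'p \<Rightarrow> 'm \<Rightarrow> 'p \<Rightarrow> 'p"
    and Pm :: "int \<Rightarrow> 'm set"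
    and Pp :: "int \<Rightarrow> 'p set"
    and em :: "'m \<Rightarrow> 'l"
    and ep :: "'p \<Rightarrow> 'l" +
  assumes generates: "lie_subalgebra s L br hull {em x + ep y | x y. True} = L"
    and center: "lie_center L br \<inter>
      bracket_span s br {em x + ep y | x y. True} {em x + ep y | x y. True} = {0}"


section \<open>The Kantor Lie algebra\<close>

text \<open>The operator on \<open>P\<^sup>- \<oplus> P\<^sup>+\<close> given by the matrix with rows \<open>a, b\<close> and \<open>c, d\<close>.\<close>

definition op_matrix ::
    "('m \<Rightarrow> 'm::ab_group_add) \<Rightarrow> ('p \<Rightarrow> 'm) \<Rightarrow> ('m \<Rightarrow> 'p) \<Rightarrow> ('p \<Rightarrow> 'p::ab_group_add) \<Rightarrow>
     'm \<times> 'p \<Rightarrow> 'm \<times> 'p" where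
  "op_matrix a b c d = (\<lambda>(x, y). (a x + b y, c x + d y))"

definition kantor_S ::
    "('k::comm_ring_1 \<Rightarrow> 'm::ab_group_add \<Rightarrow> 'm) \<Rightarrow> ('k \<Rightarrow> 'p::ab_group_add \<Rightarrow> 'p) \<Rightarrow>
     ('m \<Rightarrow> 'p \<Rightarrow> 'm \<Rightarrow> 'm) \<Rightarrow> ('p \<Rightarrow> 'm \<Rightarrow> 'p \<Rightarrow> 'p) \<Rightarrow> ('m \<times> 'p \<Rightarrow> 'm \<times> 'p) set" where
  "kantor_S sm sp tm tp =
     module.span (fun_scale (module_prod.scale sm sp))
       {op_matrix (kp_D tm xm xp) (kp_K tm ym zm) (kp_K tp yp zp) (- kp_D tp xp xm)
        | xm xp ym zm yp zp. True}"

type_synonym ('m, 'p) kantor_elem = "('m \<times> 'p \<Rightarrow> 'm \<times> 'p) \<times> ('m \<times> 'p)"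

text \<open>An element \<open>A + v\<close> of \<open>\<SS>(P) \<oplus> (P\<^sup>-, P\<^sup>+)\<^sup>T\<close> is represented by the pair \<open>(A, v)\<close>.\<close>

definition kantor_scale ::
    "('k::comm_ring_1 \<Rightarrow> 'm::ab_group_add \<Rightarrow> 'm) \<Rightarrow> ('k \<Rightarrow> 'p::ab_group_add \<Rightarrow> 'p) \<Rightarrow>
     'k \<Rightarrow> ('m, 'p) kantor_elem \<Rightarrow> ('m, 'p) kantor_elem" where
  "kantor_scale sm sp =
     module_prod.scale (fun_scale (module_prod.scale sm sp)) (module_prod.scale sm sp)"

definition kantor_algebra ::
    "('k::comm_ring_1 \<Rightarrow> 'm::ab_group_add \<Rightarrow> 'm) \<Rightarrow> ('k \<Rightarrow> 'p::ab_group_add \<Rightarrow> 'p) \<Rightarrow>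
     ('m \<Rightarrow> 'p \<Rightarrow> 'm \<Rightarrow> 'm) \<Rightarrow> ('p \<Rightarrow> 'm \<Rightarrow> 'p \<Rightarrow> 'p) \<Rightarrow> ('m, 'p) kantor_elem set" where
  "kantor_algebra sm sp tm tp = kantor_S sm sp tm tp \<times> UNIV"

definition kantor_vec_bracket ::
    "('m::ab_group_add \<Rightarrow> 'p::ab_group_add \<Rightarrow> 'm \<Rightarrow> 'm) \<Rightarrow> ('p \<Rightarrow> 'm \<Rightarrow> 'p \<Rightarrow> 'p) \<Rightarrow>
     'm \<times> 'p \<Rightarrow> 'm \<times> 'p \<Rightarrow> 'm \<times> 'p \<Rightarrow> 'm \<times> 'p" where
  "kantor_vec_bracket tm tp = (\<lambda>(xm, xp) (ym, yp).
     op_matrix (kp_D tm xm yp - kp_D tm ym xp) (kp_K tm xm ym)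
               (kp_K tp xp yp) (- kp_D tp yp xm + kp_D tp xp ym))"

definition kantor_bracket ::
    "('m::ab_group_add \<Rightarrow> 'p::ab_group_add \<Rightarrow> 'm \<Rightarrow> 'm) \<Rightarrow> ('p \<Rightarrow> 'm \<Rightarrow> 'p \<Rightarrow> 'p) \<Rightarrow>
     ('m, 'p) kantor_elem \<Rightarrow> ('m, 'p) kantor_elem \<Rightarrow> ('m, 'p) kantor_elem" where
  "kantor_bracket tm tp = (\<lambda>(A, v) (B, w).
     ((A \<circ> B) - (B \<circ> A) + kantor_vec_bracket tm tp v w, A w - B v))"

definition kantor_neg :: "'m::ab_group_add \<Rightarrow> ('m, 'p::ab_group_add) kantor_elem" where
  "kantor_neg x = (0, (x, 0))"

definition kantor_pos :: "'p::ab_group_add \<Rightarrow> ('m::ab_group_add, 'p) kantor_elem" where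
  "kantor_pos y = (0, (0, y))"

definition kantor_5_grading ::
    "('k::comm_ring_1 \<Rightarrow> 'm::ab_group_add \<Rightarrow> 'm) \<Rightarrow> ('k \<Rightarrow> 'p::ab_group_add \<Rightarrow> 'p) \<Rightarrow>
     ('m \<Rightarrow> 'p \<Rightarrow> 'm \<Rightarrow> 'm) \<Rightarrow> ('p \<Rightarrow> 'm \<Rightarrow> 'p \<Rightarrow> 'p) \<Rightarrow> int \<Rightarrow> ('m, 'p) kantor_elem set" where
  "kantor_5_grading sm sp tm tp i =
     (if i = -2 then {(A, 0) | A. A \<in> kantor_S sm sp tm tp \<and> (\<exists>b. A = op_matrix 0 b 0 0)}
      else if i = -1 then range kantor_neg
      else if i = 0 then
        module.span (kantor_scale sm sp)
          {(op_matrix (kp_D tm x y) 0 0 (- kp_D tp y x), 0) | x y. True}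
      else if i = 1 then range kantor_pos
      else if i = 2 then {(A, 0) | A. A \<in> kantor_S sm sp tm tp \<and> (\<exists>c. A = op_matrix 0 0 c 0)}
      else {0})"

text \<open>\<open>P\<^sub>i\<^sup>\<sigma>\<close> as a subset of the Kantor Lie algebra; the sign \<open>\<sigma>\<close> is \<open>1\<close> or \<open>-1\<close>.\<close>

definition kantor_component ::
    "(int \<Rightarrow> 'm::ab_group_add set) \<Rightarrow> (int \<Rightarrow> 'p::ab_group_add set) \<Rightarrow> int \<Rightarrow> int \<Rightarrow>
     ('m, 'p) kantor_elem set" where
  "kantor_component Pm Pp \<sigma> i = (if \<sigma> = 1 then kantor_pos ` Pp i else kantor_neg ` Pm i)"

definition standard_BC2_grading ::
    "('k::comm_ring_1 \<Rightarrow> 'm::ab_group_add \<Rightarrow> 'm) \<Rightarrow> ('k \<Rightarrow> 'p::ab_group_add \<Rightarrow> 'p) \<Rightarrow>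
     ('m \<Rightarrow> 'p \<Rightarrow> 'm \<Rightarrow> 'm) \<Rightarrow> ('p \<Rightarrow> 'm \<Rightarrow> 'p \<Rightarrow> 'p) \<Rightarrow> (int \<Rightarrow> 'm set) \<Rightarrow> (int \<Rightarrow> 'p set) \<Rightarrow>
     (int \<Rightarrow> int \<Rightarrow> ('m, 'p) kantor_elem set) \<Rightarrow> bool" where
  "standard_BC2_grading sm sp tm tp Pm Pp G \<longleftrightarrow>
     BC2_graded_lie_algebra (kantor_scale sm sp) (kantor_algebra sm sp tm tp)
       (kantor_bracket tm tp) G \<and>
     (\<forall>\<sigma>\<in>{-1, 1}. \<forall>i. G (\<sigma> * 1) (\<sigma> * i) = kantor_component Pm Pp \<sigma> i)"

end

theory Submission
  imports Defs
begin

text \<open>The algebra is spanned by the column vectors and their brackets, and each operator in the span of the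
  brackets is a derivation of the bracket of vectors: for diagonal blocks this is (K1), for
  triangular blocks (K2) and a consequence of (K1). So giving \<open>[v, w]\<close> the sum of the
  degrees of \<open>v\<close> and \<open>w\<close> yields a grading. The sum is direct because a homogeneous
  operator shifts the degrees of vectors. Any other grading with the same vectors contains this one
  componentwise, and two direct sum decompositions of one module cannot be properly nested.\<close>

section \<open>Internal direct sums\<close>

text \<open>The delicate point is the composite of two operators \<open>K\<close> of opposite sign.
  For a triangular operator to be a derivation, its commutator with an operator in the opposite
  corner must be diagonal with prescribed entries. The two entries are the two orders of
  composition, and they ask for two different expressions through operators \<open>D\<close>. One
  follows from (K2); the other is the same after a rewriting that holds because the left side of
  (K1) changes sign when its two operators are exchanged. The Jacobi identity then splits by the
  number of vectors involved: three vectors give a cyclic identity that \<open>K\<close> is designed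
  to satisfy, two vectors and an operator give the derivation property, and the remaining cases are
  associativity of composition. The comparison with the standard 5-grading has its own obstacle. The
  components of degree -2 and 2 are cut out of S(P) by a triangular shape, which does not present
  their elements as combinations of operators \<open>K\<close>. Linear projections onto the corner
  blocks supply such a presentation.\<close>

lemma module_fun_scale:
  assumes "module s"
  shows "module (fun_scale s :: 'k::comm_ring_1 \<Rightarrow> ('a \<Rightarrow> 'b::ab_group_add) \<Rightarrow> 'a \<Rightarrow> 'b)"
proof -
  interpret module s by fact
  show ?thesis
    by unfold_locales
      (simp_all add: fun_scale_def fun_eq_iff scale_left_distrib scale_right_distrib)
qed

text \<open>Uniqueness of decompositions concerns families on the whole index type. So
  \<open>g\<close> is extended by zero outside \<open>J\<close> and compared with the zero family,
  since both represent 0.\<close>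

lemma internal_direct_sum_imp_0:
  assumes "module s" and A: "internal_direct_sum s L A"
    and J: "finite J" "\<And>i. i \<in> J \<Longrightarrow> g i \<in> A i" "sum g J = 0" and i: "i \<in> J"
  shows "g i = 0"
proof -
  interpret module s by fact
  have sub: "subspace (A i)" for i
    using A by (simp add: internal_direct_sum_def)
  define f where "f i = (if i \<in> J then g i else 0)" for i
  have "sum f {i. f i \<noteq> 0} = sum f J"
    by (rule sum.mono_neutral_left) (auto simp: f_def J split: if_splits)
  also have "\<dots> = 0"
    using J(3) by (simp add: f_def cong: sum.cong)
  finally have "sum f {i. f i \<noteq> 0} = 0" .
  moreover have "finite {i. f i \<noteq> 0}"
    by (rule finite_subset[OF _ J(1)]) (auto simp: f_def split: if_splits)
  moreover have "\<forall>i. f i \<in> A i"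
    using J sub by (auto simp: f_def subspace_0)
  moreover have "\<exists>!f. (\<forall>i. f i \<in> A i) \<and> finite {i. f i \<noteq> 0} \<and> 0 = (\<Sum>i | f i \<noteq> 0. f i)"
    using A subspace_0[of L] unfolding internal_direct_sum_def by blast
  ultimately have "f = (\<lambda>_. 0)"
    using sub by (elim ex1E) (metis (mono_tags, lifting) Collect_empty_eq finite.emptyI subspace_0 sum.empty)
  then show ?thesis
    using i by (metis f_def)
qed

lemma internal_direct_sum_decomp:
  assumes "internal_direct_sum s L A" "x \<in> L"
  obtains f J where "finite J" "\<And>i. f i \<in> A i" "x = sum f J"
  using assms unfolding internal_direct_sum_def by blast

text \<open>Terms with the same index merge, as each \<open>A i\<close> is closed under addition: a
  new term from \<open>A j\<close> is absorbed into the entry at \<open>j\<close>, whether or not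
  that entry was zero.\<close>

lemma (in module) span_UN_decomp:
  assumes A: "\<And>i. subspace (A i)" and x: "x \<in> span (\<Union>i. A i)"
  shows "\<exists>f. (\<forall>i. f i \<in> A i) \<and> finite {i. f i \<noteq> 0} \<and> x = (\<Sum>i | f i \<noteq> 0. f i)"
  using x
proof (induction rule: span_induct_alt)
  case base
  show ?case
    using A by (intro exI[of _ "\<lambda>_. 0"]) (simp add: subspace_0)
next
  case (step c x y)
  obtain j where j: "x \<in> A j"
    using step by blast
  obtain f where f: "\<And>i. f i \<in> A i" "finite {i. f i \<noteq> 0}" "y = (\<Sum>i | f i \<noteq> 0. f i)"
    using step by blast
  define g where "g = f(j := c *s x + f j)"
  let ?J = "insert j {i. f i \<noteq> 0}"
  have "(\<Sum>i | g i \<noteq> 0. g i) = sum g ?J"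
    by (rule sum.mono_neutral_left) (auto simp: g_def f split: if_splits)
  also have "\<dots> = g j + sum f (?J - {j})"
    using f(2) by (subst sum.insert_remove) (auto simp: g_def intro!: sum.cong)
  also have "\<dots> = c *s x + sum f ?J"
    using f(2) by (simp add: sum.insert_remove g_def)
  also have "sum f ?J = y"
    unfolding f(3) by (rule sum.mono_neutral_right) (auto simp: f(2))
  finally have "c *s x + y = (\<Sum>i | g i \<noteq> 0. g i)" by simp
  moreover have "finite {i. g i \<noteq> 0}"
    by (rule finite_subset[of _ ?J]) (auto simp: g_def f(2))
  moreover have "g i \<in> A i" for i
    using A j f(1) by (auto simp: g_def subspace_add subspace_scale)
  ultimately show ?case by blast
qed

text \<open>Uniqueness comes from independence applied to the difference of two families over the
  union of their supports.\<close>

lemma internal_direct_sumI: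
  assumes "module s" and L: "module.subspace s L"
    and A: "\<And>i. module.subspace s (A i)" "\<And>i. A i \<subseteq> L" "L \<subseteq> module.span s (\<Union>i. A i)"
    and indep: "\<And>J g i. finite J \<Longrightarrow> (\<And>i. i \<in> J \<Longrightarrow> g i \<in> A i) \<Longrightarrow> sum g J = 0 \<Longrightarrow> i \<in> J \<Longrightarrow> g i = 0"
  shows "internal_direct_sum s L A"
proof -
  interpret module s by fact
  have "f = g" if fg: "\<And>i. f i \<in> A i" "finite {i. f i \<noteq> 0}" "\<And>i. g i \<in> A i" "finite {i. g i \<noteq> 0}"
    "(\<Sum>i | f i \<noteq> 0. f i) = (\<Sum>i | g i \<noteq> 0. g i)" for f g
  proof
    fix i
    let ?J = "{i. f i \<noteq> 0} \<union> {i. g i \<noteq> 0}"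
    have "(\<Sum>i | f i \<noteq> 0. f i) = sum f ?J" "(\<Sum>i | g i \<noteq> 0. g i) = sum g ?J"
      by (rule sum.mono_neutral_left; use fg in auto)+
    then have "(\<Sum>i\<in>?J. f i - g i) = 0"
      using fg(5) by (simp add: sum_subtractf)
    then have "f i - g i = 0" if "i \<in> ?J"
      using indep[of ?J "\<lambda>i. f i - g i" i] fg A(1) that by (auto simp: subspace_diff)
    then show "f i = g i" by (cases "i \<in> ?J") auto
  qed
  moreover have "\<exists>f. (\<forall>i. f i \<in> A i) \<and> finite {i. f i \<noteq> 0} \<and> x = (\<Sum>i | f i \<noteq> 0. f i)" if "x \<in> L" for x
    using span_UN_decomp[of A x] A that by blast
  ultimately show ?thesis
    using L A(1,2) unfolding internal_direct_sum_def by (simp add: Ex1_def) metis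
qed

lemma internal_direct_sum_span:
  assumes "module s" "internal_direct_sum s L A"
  shows "module.span s (\<Union>i. A i) = L"
proof -
  interpret module s by fact
  have "span (\<Union>i. A i) \<subseteq> L"
    using assms by (intro span_minimal) (auto simp: internal_direct_sum_def)
  moreover have "x \<in> span (\<Union>i. A i)" if "x \<in> L" for x
  proof -
    obtain f J where "\<And>i. f i \<in> A i" "x = sum f J"
      using internal_direct_sum_decomp[OF assms(2) \<open>x \<in> L\<close>] by metis
    then show ?thesis
      by (blast intro: span_sum span_base)
  qed
  ultimately show ?thesis by blast
qed

text \<open>For \<open>x\<close> in \<open>B i\<close>, the decomposition of \<open>x\<close> along
  \<open>A\<close> is also one along \<open>B\<close>. The other one along \<open>B\<close> is
  \<open>x\<close> alone in position \<open>i\<close>; their difference is \<open>?g\<close>, so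
  \<open>x = f i\<close>.\<close>

lemma internal_direct_sum_subset_imp_eq:
  assumes "module s" and A: "internal_direct_sum s L A" and B: "internal_direct_sum s L B"
    and AB: "\<And>i. A i \<subseteq> B i"
  shows "A = B"
proof (intro ext equalityI AB subsetI)
  interpret module s by fact
  fix i x assume x: "x \<in> B i"
  then have "x \<in> L"
    using B by (auto simp: internal_direct_sum_def)
  then obtain f where f: "\<And>i. f i \<in> A i" "finite {i. f i \<noteq> 0}" "x = (\<Sum>i | f i \<noteq> 0. f i)"
    using A unfolding internal_direct_sum_def by blast
  let ?J = "insert i {i. f i \<noteq> 0}"
  let ?g = "\<lambda>j. f j - (if j = i then x else 0)"
  have "x = sum f ?J"
    unfolding f(3) by (rule sum.mono_neutral_left) (auto simp: f(2))
  then have "sum ?g ?J = 0"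
    using f(2) by (simp add: sum_subtractf)
  moreover have "?g j \<in> B j" for j
    using subsetD[OF AB f(1)] B x
    by (auto simp: internal_direct_sum_def subspace_diff)
  ultimately have "?g i = 0"
    using internal_direct_sum_imp_0[OF \<open>module s\<close> B, of ?J ?g i] f(2) by blast
  then show "x \<in> A i"
    using f(1)[of i] by simp
qed

lemma (in module_prod) internal_direct_sum_Times:
  assumes A: "internal_direct_sum s1 L A" and B: "internal_direct_sum s2 M B"
  shows "internal_direct_sum scale (L \<times> M) (\<lambda>i. A i \<times> B i)"
proof (rule internal_direct_sumI)
  have sub: "m1.subspace L" "m2.subspace M" "m1.subspace (A i)" "m2.subspace (B i)"
    "A i \<subseteq> L" "B i \<subseteq> M" for i
    using A B by (auto simp: internal_direct_sum_def)
  show "p.subspace (L \<times> M)" "p.subspace (A i \<times> B i)" "A i \<times> B i \<subseteq> L \<times> M" for i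
    using sub by (blast intro: subspace_Times)+
  have 1: "module_hom s1 scale (\<lambda>x. (x, 0))" and 2: "module_hom s2 scale (\<lambda>y. (0, y))"
    by unfold_locales (auto simp: scale_prod)
  show "L \<times> M \<subseteq> p.span (\<Union>i. A i \<times> B i)"
  proof clarify
    fix x y assume "x \<in> L" "y \<in> M"
    then obtain f J g K where f: "\<And>i. f i \<in> A i" "x = sum f J" and g: "\<And>i. g i \<in> B i" "y = sum g K"
      using internal_direct_sum_decomp[OF A] internal_direct_sum_decomp[OF B] by metis
    have "(x, y) = (\<Sum>i\<in>J. (f i, 0)) + (\<Sum>i\<in>K. (0, g i))"
      unfolding f(2) g(2) module_hom.sum[OF 1, symmetric] module_hom.sum[OF 2, symmetric] by simp
    also have "\<dots> \<in> p.span (\<Union>i. A i \<times> B i)"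
      using f(1) g(1) m1.subspace_0[OF sub(3)] m2.subspace_0[OF sub(4)]
      by (intro p.span_add p.span_sum p.span_base) blast+
    finally show "(x, y) \<in> p.span (\<Union>i. A i \<times> B i)" .
  qed
  fix J and g :: "_ \<Rightarrow> _ \<times> _" and i
  assume J: "finite J" "\<And>i. i \<in> J \<Longrightarrow> g i \<in> A i \<times> B i" "sum g J = 0" "i \<in> J"
  then have "(\<Sum>i\<in>J. fst (g i)) = 0" "(\<Sum>i\<in>J. snd (g i)) = 0"
    by (metis fst_sum fst_zero, metis snd_sum snd_zero)
  then have "fst (g i) = 0" "snd (g i) = 0"
    using internal_direct_sum_imp_0[OF m1.module_axioms A J(1), of "\<lambda>i. fst (g i)" i]
      internal_direct_sum_imp_0[OF m2.module_axioms B J(1), of "\<lambda>i. snd (g i)" i] J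
    by (auto simp: mem_Times_iff)
  then show "g i = 0"
    by (simp add: prod_eq_iff)
qed (rule p.module_axioms)

section \<open>The Kantor Lie algebra\<close>

context kantor_pair
begin

section \<open>Module structures and the trilinearity rules\<close>

abbreviation "sV \<equiv> module_prod.scale sm sp"
abbreviation "sE \<equiv> fun_scale sV :: 'k \<Rightarrow> ('m \<times> 'p \<Rightarrow> 'm \<times> 'p) \<Rightarrow> 'm \<times> 'p \<Rightarrow> 'm \<times> 'p"
abbreviation "sK \<equiv> kantor_scale sm sp"
abbreviation "vec \<equiv> kantor_vec_bracket tm tp"
abbreviation "SS \<equiv> kantor_S sm sp tm tp"
abbreviation "KK \<equiv> kantor_algebra sm sp tm tp"
abbreviation "brK \<equiv> kantor_bracket tm tp"

sublocale VP: module_prod sm sp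
  by unfold_locales

sublocale E: module sE
  by (rule module_fun_scale) (rule VP.p.module_axioms)

sublocale KP: module_prod sE sV
  by unfold_locales

lemma sK_eq: "sK = KP.scale"
  by (simp add: kantor_scale_def)

sublocale KM: module sK
  unfolding sK_eq by (rule KP.p.module_axioms)

lemma sK_Pair [simp]: "sK c (A, v) = (sE c A, sV c v)"
  by (simp add: sK_eq KP.scale_prod)

lemma sE_apply [simp]: "sE c A v = sV c (A v)"
  by (simp add: fun_scale_def)

lemma tm_linear:
  "tm (x + x') y z = tm x y z + tm x' y z" "tm x (y + y') z = tm x y z + tm x y' z"
  "tm x y (z + z') = tm x y z + tm x y z'"
  "tm (sm c x) y z = sm c (tm x y z)" "tm x (sp c y) z = sm c (tm x y z)"
  "tm x y (sm c z) = sm c (tm x y z)"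
  using trilinear_neg unfolding trilinear_def module_hom_iff by blast+

lemma tp_linear:
  "tp (x + x') y z = tp x y z + tp x' y z" "tp x (y + y') z = tp x y z + tp x y' z"
  "tp x y (z + z') = tp x y z + tp x y z'"
  "tp (sp c x) y z = sp c (tp x y z)" "tp x (sm c y) z = sp c (tp x y z)"
  "tp x y (sp c z) = sp c (tp x y z)"
  using trilinear_pos unfolding trilinear_def module_hom_iff by blast+

lemma tm_zero [simp]: "tm 0 y z = 0" "tm x 0 z = 0" "tm x y 0 = 0"
  using tm_linear(1)[of 0 0 y z] tm_linear(2)[of x 0 0 z] tm_linear(3)[of x y 0 0] by simp_all

lemma tp_zero [simp]: "tp 0 y z = 0" "tp x 0 z = 0" "tp x y 0 = 0"
  using tp_linear(1)[of 0 0 y z] tp_linear(2)[of x 0 0 z] tp_linear(3)[of x y 0 0] by simp_all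

lemma tm_neg: "tm (- x) y z = - tm x y z" "tm x (- y) z = - tm x y z" "tm x y (- z) = - tm x y z"
  using tm_linear(1)[of "-x" x y z] tm_linear(2)[of x "-y" y z] tm_linear(3)[of x y "-z" z]
  by (simp_all add: eq_neg_iff_add_eq_0)

lemma tp_neg: "tp (- x) y z = - tp x y z" "tp x (- y) z = - tp x y z" "tp x y (- z) = - tp x y z"
  using tp_linear(1)[of "-x" x y z] tp_linear(2)[of x "-y" y z] tp_linear(3)[of x y "-z" z]
  by (simp_all add: eq_neg_iff_add_eq_0)

lemma tm_diff:
  "tm (x - x') y z = tm x y z - tm x' y z" "tm x (y - y') z = tm x y z - tm x y' z"
  "tm x y (z - z') = tm x y z - tm x y z'"
  unfolding diff_conv_add_uminus tm_linear tm_neg by simp_all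

lemma tp_diff:
  "tp (x - x') y z = tp x y z - tp x' y z" "tp x (y - y') z = tp x y z - tp x y' z"
  "tp x y (z - z') = tp x y z - tp x y z'"
  unfolding diff_conv_add_uminus tp_linear tp_neg by simp_all

abbreviation "km \<equiv> kp_K tm"
abbreviation "kp \<equiv> kp_K tp"

lemma km_def: "km x z y = tm x y z - tm z y x"
  by (simp add: kp_K_def)

lemma kp_def: "kp x z y = tp x y z - tp z y x"
  by (simp add: kp_K_def)

section \<open>The Kantor identities at elements, and composites of two operators
  \<open>K\<close>\<close>

lemma tm_K1: "tm x y (tm z w u) = tm (tm x y z) w u - tm z (tp y x w) u + tm z w (tm x y u)"
  using K1_neg unfolding kantor_identity_1_def kp_D_def fun_eq_iff
  by (simp add: algebra_simps)

lemma tp_K1: "tp x y (tp z w u) = tp (tp x y z) w u - tp z (tm y x w) u + tp z w (tp x y u)"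
  using K1_pos unfolding kantor_identity_1_def kp_D_def fun_eq_iff
  by (simp add: algebra_simps)

lemma tm_K2: "km x z (tp w u y) + tm u w (km x z y) = km (km x z w) u y"
  using K2_neg unfolding kantor_identity_2_def kp_D_def fun_eq_iff by simp

lemma tp_K2: "kp x z (tm w u y) + tp u w (kp x z y) = kp (kp x z w) u y"
  using K2_pos unfolding kantor_identity_2_def kp_D_def fun_eq_iff by simp

text \<open>Splitting \<open>kp v w y\<close> into its two products and applying (K2) to each
  leaves, besides the stated terms, an expression symmetric in \<open>v\<close> and
  \<open>w\<close>, which cancels in the difference.\<close>

lemma K_comp_K_neg: "km x z (kp v w y) = tm (km x z v) w y - tm (km x z w) v y"
proof -
  have "km x z (kp v w y) = km x z (tp v y w) - km x z (tp w y v)"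
    unfolding km_def kp_def tm_diff by simp
  moreover have "km x z (tp v y w) = tm (km x z v) w y - tm y w (km x z v) - tm y v (km x z w)"
    using tm_K2[of x z v y w] by (simp only: km_def[of "km x z v"] eq_diff_eq)
  moreover have "km x z (tp w y v) = tm (km x z w) v y - tm y v (km x z w) - tm y w (km x z v)"
    using tm_K2[of x z w y v] by (simp only: km_def[of "km x z w"] eq_diff_eq)
  ultimately show ?thesis
    by simp
qed

lemma K_comp_K_pos: "kp x z (km v w y) = tp (kp x z v) w y - tp (kp x z w) v y"
proof -
  have "kp x z (km v w y) = kp x z (tm v y w) - kp x z (tm w y v)"
    unfolding km_def kp_def tp_diff by simp
  moreover have "kp x z (tm v y w) = tp (kp x z v) w y - tp y w (kp x z v) - tp y v (kp x z w)"
    using tp_K2[of x z v y w] by (simp only: kp_def[of "kp x z v"] eq_diff_eq)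
  moreover have "kp x z (tm w y v) = tp (kp x z w) v y - tp y v (kp x z w) - tp y w (kp x z v)"
    using tp_K2[of x z w y v] by (simp only: kp_def[of "kp x z w"] eq_diff_eq)
  ultimately show ?thesis
    by simp
qed

text \<open>Antisymmetry of the commutator in (K1).\<close>

lemma D_swap_neg: "tm (tm x y z) w u + tm (tm z w x) y u = tm z (tp y x w) u + tm x (tp w z y) u"
  using tm_K1[of x y z w u] tm_K1[of z w x y u] by (simp add: algebra_simps)

lemma D_swap_pos: "tp (tp x y z) w u + tp (tp z w x) y u = tp z (tm y x w) u + tp x (tm w z y) u"
  using tp_K1[of x y z w u] tp_K1[of z w x y u] by (simp add: algebra_simps)

text \<open>Here the inner \<open>K\<close> acts on the entries of the outer one, while in
  \<open>K_comp_K_neg\<close> the outer acts on the entries of the inner. The derivation property of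
  a triangular operator needs the first form when that operator is applied last and the second when
  it is applied first.\<close>

lemma K_comp_K_neg': "km x z (kp v w y) = tm z (kp v w x) y - tm x (kp v w z) y"
  unfolding K_comp_K_neg unfolding km_def kp_def tm_diff
  using D_swap_neg[of x v z w y] D_swap_neg[of z v x w y] by (simp add: algebra_simps)

lemma K_comp_K_pos': "kp x z (km v w y) = tp z (km v w x) y - tp x (km v w z) y"
  unfolding K_comp_K_pos unfolding km_def kp_def tp_diff
  using D_swap_pos[of x v z w y] D_swap_pos[of z v x w y] by (simp add: algebra_simps)

section \<open>The bracket of two column vectors as an operator\<close>

lemma vec_apply:
  "vec v w u =
    (tm (fst v) (snd w) (fst u) - tm (fst w) (snd v) (fst u) + km (fst v) (fst w) (snd u),
     kp (snd v) (snd w) (fst u) + (tp (snd v) (fst w) (snd u) - tp (snd w) (fst v) (snd u)))"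
  by (simp add: kantor_vec_bracket_def op_matrix_def kp_D_def split_beta)

lemma vec_add: "vec (v + v') w = vec v w + vec v' w" "vec v (w + w') = vec v w + vec v w'"
  by (simp_all add: fun_eq_iff vec_apply km_def kp_def tm_linear tp_linear algebra_simps)

lemma vec_scale: "vec (sV c v) w = sE c (vec v w)" "vec v (sV c w) = sE c (vec v w)"
  by (simp_all add: fun_eq_iff vec_apply km_def kp_def tm_linear tp_linear VP.scale_def
     neg.scale_right_distrib neg.scale_right_diff_distrib
     pos.scale_right_distrib pos.scale_right_diff_distrib)

lemma vec_hom_left: "module_hom sV sE (\<lambda>v. vec v w)"
  by unfold_locales (rule vec_add vec_scale)+

lemma vec_hom_right: "module_hom sV sE (vec v)"
  by unfold_locales (rule vec_add vec_scale)+

lemma vec_linear: "module_hom sV sV (vec v w)"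
  by unfold_locales (simp_all add: vec_apply km_def kp_def tm_linear tp_linear VP.scale_def
     neg.scale_right_distrib neg.scale_right_diff_distrib
     pos.scale_right_distrib pos.scale_right_diff_distrib algebra_simps)

lemma vec_zero [simp]: "vec 0 w = 0" "vec v 0 = 0"
  by (simp_all add: fun_eq_iff vec_apply kp_def km_def flip: zero_prod_def)

lemma vec_self [simp]: "vec v v = 0"
  by (simp add: fun_eq_iff vec_apply kp_def km_def zero_prod_def)

lemma vec_apply_zero [simp]: "vec v w 0 = 0"
  using vec_linear by (rule module_hom.zero)

lemma vec_anti: "vec v w = - vec w v"
  by (simp add: fun_eq_iff vec_apply kp_def km_def)

text \<open>This is the Jacobi identity for three vectors. The products \<open>D\<close> cancel
  against the \<open>K\<close> because \<open>K\<close> is the antisymmetrization of the product in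
  its outer arguments.\<close>

lemma vec_cyclic: "vec u v w + vec v w u + vec w u v = 0"
  by (simp add: fun_eq_iff vec_apply kp_def km_def zero_prod_def)

section \<open>Derivations of the vector bracket\<close>

definition derivations :: "('m \<times> 'p \<Rightarrow> 'm \<times> 'p) set" where
  "derivations = {A. module_hom sV sV A \<and>
     (\<forall>v w u. A (vec v w u) - vec v w (A u) = vec (A v) w u + vec v (A w) u)}"

text \<open>The defining condition is the Jacobi identity for one operator and two vectors. It is
  linear in the operator, so it passes from generators to all of S(P).\<close>

lemma subspace_derivations: "E.subspace derivations"
proof (rule E.subspaceI)
  show "0 \<in> derivations"
    by (auto simp: derivations_def module_hom_iff VP.p.module_axioms)
next
  fix A B assume A: "A \<in> derivations" and B: "B \<in> derivations"
  interpret A: module_hom sV sV A using A by (simp add: derivations_def)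
  interpret B: module_hom sV sV B using B by (simp add: derivations_def)
  have "module_hom sV sV (A + B)"
    by unfold_locales (simp_all add: A.add B.add A.scale B.scale VP.p.scale_right_distrib)
  moreover have "vec v w (x + y) = vec v w x + vec v w y" for v w x y
    using vec_linear by (rule module_hom.add)
  ultimately show "A + B \<in> derivations" using A B
    by (simp add: derivations_def vec_add algebra_simps)
next
  fix A c assume A: "A \<in> derivations"
  interpret A: module_hom sV sV A using A by (simp add: derivations_def)
  have "module_hom sV sV (sE c A)"
    by unfold_locales (simp_all add: A.add A.scale VP.p.scale_right_distrib mult.commute)
  moreover have "vec v w (sV c x) = sV c (vec v w x)" for v w x
    using vec_linear by (rule module_hom.scale)
  ultimately show "sE c A \<in> derivations" using A
    by (simp add: derivations_def vec_scale flip: VP.p.scale_right_diff_distrib VP.p.scale_right_distrib)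
qed

lemma vec_split: "vec (a, b) (c, d) = vec (a, 0) (c, 0) + vec (a, 0) (0, d) + vec (0, b) (c, 0) + vec (0, b) (0, d)"
  using vec_add(1)[of "(a, 0)" "(0, b)" "(c, d)"] vec_add(2)[of _ "(c, 0)" "(0, d)"] by simp

lemma vec_blocks:
  "vec (a, 0) (0, d) (p, q) = (tm a d p, - tp d a q)"
  "vec (0, b) (c, 0) (p, q) = (- tm c b p, tp b c q)"
  "vec (a, 0) (c, 0) (p, q) = (km a c q, 0)"
  "vec (0, b) (0, d) (p, q) = (0, kp b d p)"
  by (simp_all add: vec_apply kp_def km_def)

text \<open>(K1) is used only with \<open>x\<close>, \<open>y\<close> as the entries of its first
  operator: this pushes the fixed operator into the triple products, and trilinearity does the
  rest.\<close>

lemma derivation_D: "vec (x, 0) (0, y) \<in> derivations"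
  by (auto simp: derivations_def vec_linear vec_blocks vec_apply km_def kp_def
      tm_linear tm_diff tm_neg tp_linear tp_diff tp_neg tm_K1[of x y] tp_K1[of y x] algebra_simps)

lemma derivation_K_neg: "vec (x, 0) (z, 0) \<in> derivations"
proof -
  define k where "k = km x z"
  have "k (a + b) = k a + k b" "k (a - b) = k a - k b" "k (- a) = - k a" for a b
    by (simp_all add: k_def km_def tm_linear tm_diff tm_neg)
  moreover have "k (tp w u y) = tm (k w) y u - tm u y (k w) - tm u w (k y)" for w u y
    using tm_K2[of x z w u y] unfolding k_def[symmetric] km_def by (simp add: algebra_simps)
  moreover have "k (kp v w y) = tm (k v) w y - tm (k w) v y" for v w y
    unfolding k_def by (rule K_comp_K_neg)
  moreover have "kp v w (k y) = tp w (k v) y - tp v (k w) y" for v w y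
    unfolding k_def by (rule K_comp_K_pos')
  ultimately have "vec (x, 0) (z, 0) (vec v w u) - vec v w (vec (x, 0) (z, 0) u) =
      vec (vec (x, 0) (z, 0) v) w u + vec v (vec (x, 0) (z, 0) w) u" for v w u
    \<comment> \<open>At first only those \<open>K\<close> are expanded that have a value of
      \<open>k\<close> among their entries. The composites \<open>k (kp v w y)\<close> and
      \<open>kp v w (k y)\<close> have to stay whole for the relations above to apply.\<close>
    by (cases v; cases w; cases u)
      (simp add: vec_blocks vec_apply k_def[symmetric] km_def[of "k _"] km_def[of _ "k _"],
        simp add: km_def kp_def)
  then show ?thesis
    by (simp add: derivations_def vec_linear)
qed

lemma derivation_K_pos: "vec (0, x) (0, z) \<in> derivations"
proof -
  define k where "k = kp x z"
  have "k (a + b) = k a + k b" "k (a - b) = k a - k b" "k (- a) = - k a" for a b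
    by (simp_all add: k_def kp_def tp_linear tp_diff tp_neg)
  moreover have "k (tm w u y) = tp (k w) y u - tp u y (k w) - tp u w (k y)" for w u y
    using tp_K2[of x z w u y] unfolding k_def[symmetric] kp_def by (simp add: algebra_simps)
  moreover have "k (km v w y) = tp (k v) w y - tp (k w) v y" for v w y
    unfolding k_def by (rule K_comp_K_pos)
  moreover have "km v w (k y) = tm w (k v) y - tm v (k w) y" for v w y
    unfolding k_def by (rule K_comp_K_neg')
  ultimately have "vec (0, x) (0, z) (vec v w u) - vec v w (vec (0, x) (0, z) u) =
      vec (vec (0, x) (0, z) v) w u + vec v (vec (0, x) (0, z) w) u" for v w u
    by (cases v; cases w; cases u)
      (simp add: vec_blocks vec_apply k_def[symmetric] kp_def[of "k _"] kp_def[of _ "k _"],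
        simp add: km_def kp_def)
  then show ?thesis
    by (simp add: derivations_def vec_linear)
qed

lemma vec_derivation: "vec v w \<in> derivations"
proof (cases v; cases w)
  fix a b c d assume "v = (a, b)" "w = (c, d)"
  moreover have "vec (0, b) (c, 0) \<in> derivations"
    by (subst vec_anti) (intro E.subspace_neg subspace_derivations derivation_D)
  ultimately show ?thesis
    by (simp add: vec_split[of a b c d] E.subspace_add subspace_derivations
        derivation_D derivation_K_neg derivation_K_pos)
qed

section \<open>The operators in S(P) and the Lie algebra axioms\<close>

lemma kantor_S_eq: "SS = E.span {vec v w | v w. True}"
proof -
  let ?g = "\<lambda>xm xp ym zm yp zp. op_matrix (kp_D tm xm xp) (km ym zm) (kp yp zp) (- kp_D tp xp xm)"
  have g: "?g xm xp ym zm yp zp = vec (xm, 0) (0, xp) + vec (ym, 0) (zm, 0) + vec (0, yp) (0, zp)"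
    for xm xp ym zm yp zp
    by (auto simp: fun_eq_iff op_matrix_def vec_blocks kp_D_def)
  \<comment> \<open>A bracket of two vectors has two diagonal contributions, \<open>D(a,d)\<close>
    and \<open>-D(c,b)\<close>, but a generator of S(P) carries only one. A second, purely diagonal
    generator is therefore subtracted.\<close>
  have v: "vec (a, b) (c, d) = ?g a d a c b d - ?g c b 0 0 0 0" for a b c d
    by (auto simp: fun_eq_iff op_matrix_def vec_apply kp_D_def km_def kp_def)
  show ?thesis
    unfolding kantor_S_def E.span_eq
  proof (intro conjI subsetI)
    fix A assume "A \<in> {?g xm xp ym zm yp zp | xm xp ym zm yp zp. True}"
    then show "A \<in> E.span {vec v w | v w. True}"
      unfolding g by (blast intro: E.span_add E.span_base)
  next
    fix A assume "A \<in> {vec v w | v w. True}"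
    then obtain a b c d where "A = vec (a, b) (c, d)"
      by auto
    then show "A \<in> E.span {?g xm xp ym zm yp zp | xm xp ym zm yp zp. True}"
      unfolding v by (blast intro: E.span_diff E.span_base)
  qed
qed

lemma vec_in_S: "vec v w \<in> SS"
  unfolding kantor_S_eq by (blast intro: E.span_base)

lemma subspace_S: "E.subspace SS"
  unfolding kantor_S_eq by simp

lemma S_derivation: "A \<in> SS \<Longrightarrow> A \<in> derivations"
  unfolding kantor_S_eq
  by (erule E.span_induct) (auto simp: subspace_derivations vec_derivation)

lemma S_linear: "A \<in> SS \<Longrightarrow> module_hom sV sV A"
  using S_derivation by (simp add: derivations_def)

lemma S_vec: "A \<in> SS \<Longrightarrow> (A \<circ> vec v w) - (vec v w \<circ> A) = vec (A v) w + vec v (A w)"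
  using S_derivation[of A] by (simp add: derivations_def fun_eq_iff del: split_paired_All)

text \<open>Commuting with a fixed linear \<open>A\<close> is linear in \<open>B\<close>, so
  generators suffice. This serves both for closure of S(P) and for its graded refinement, where
  \<open>X\<close> consists of brackets of vectors and \<open>T\<close> is a component.\<close>

lemma commutator_span:
  assumes A: "module_hom sV sV A" and B: "B \<in> E.span X" and T: "E.subspace T"
    and X: "\<And>C. C \<in> X \<Longrightarrow> (A \<circ> C) - (C \<circ> A) \<in> T"
  shows "(A \<circ> B) - (B \<circ> A) \<in> T"
  using B
proof (induction rule: E.span_induct)
  interpret A: module_hom sV sV A by fact
  have "module_hom sE sE (\<lambda>B. (A \<circ> B) - (B \<circ> A))"
    by unfold_locales (simp_all add: fun_eq_iff A.add A.scale VP.p.scale_right_diff_distrib)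
  from module_hom.subspace_linear_preimage[OF this T]
  show "E.subspace (Collect (\<lambda>B. (A \<circ> B) - (B \<circ> A) \<in> T))" .
qed (rule X)

lemma S_commutator:
  assumes "A \<in> SS" "B \<in> SS"
  shows "(A \<circ> B) - (B \<circ> A) \<in> SS"
proof (rule commutator_span[OF S_linear])
  show "B \<in> E.span {vec v w | v w. True}"
    using assms by (simp only: kantor_S_eq)
qed (use assms in \<open>auto simp: subspace_S S_vec vec_in_S E.subspace_add simp del: split_paired_Ex\<close>)

lemma brK_Pair: "brK (A, v) (B, w) = ((A \<circ> B) - (B \<circ> A) + vec v w, A w - B v)"
  by (simp add: kantor_bracket_def)

lemma kantor_lie_algebra: "lie_algebra sK KK brK"
proof
  show "KM.subspace KK"
    unfolding sK_eq kantor_algebra_def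
    by (rule KP.subspace_Times) (simp_all add: subspace_S)
next
  fix x y z c assume x: "x \<in> KK" and y: "y \<in> KK"
  obtain A u where [simp]: "x = (A, u)" by (cases x)
  obtain B v where [simp]: "y = (B, v)" by (cases y)
  have A: "A \<in> SS" and B: "B \<in> SS"
    using x y by (simp_all add: kantor_algebra_def)
  interpret A: module_hom sV sV A using A by (rule S_linear)
  interpret B: module_hom sV sV B using B by (rule S_linear)
  show "brK x y \<in> KK"
    using A B by (simp add: brK_Pair kantor_algebra_def S_commutator subspace_S E.subspace_add vec_in_S)
  show "brK (sK c x) y = sK c (brK x y)" "brK x (sK c y) = sK c (brK x y)"
    by (simp_all add: brK_Pair fun_eq_iff vec_scale A.scale B.scale VP.p.scale_right_diff_distrib
        VP.p.scale_right_distrib)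
  show "brK x x = 0"
    by (simp add: brK_Pair zero_prod_def)
  assume z: "z \<in> KK"
  obtain C w where [simp]: "z = (C, w)" by (cases z)
  have C: "C \<in> SS"
    using z by (simp add: kantor_algebra_def)
  interpret C: module_hom sV sV C using C by (rule S_linear)
  show "brK (x + y) z = brK x z + brK y z" "brK x (y + z) = brK x y + brK x z"
    by (simp_all add: brK_Pair fun_eq_iff vec_add A.add B.add C.add)
  have *: "D (vec p q r) = vec p q (D r) + vec (D p) q r + vec p (D q) r" if "D \<in> SS" for D p q r
    using fun_cong[OF S_vec[OF that, of p q], of r] by (simp add: algebra_simps)
  have **: "vec (D p - E q) r = vec (D p) r - vec (E q) r" for D E :: "'m \<times> 'p \<Rightarrow> 'm \<times> 'p" and p q r
    using vec_hom_left by (rule module_hom.diff)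
  \<comment> \<open>In the vector component the operator values cancel and \<open>vec_cyclic\<close>
    remains. In the operator component the triple commutators cancel by associativity, and the
    commutators with brackets of vectors cancel by the derivation property.\<close>
  show "brK (brK x y) z + brK (brK y z) x + brK (brK z x) y = 0"
    using vec_cyclic[of u v w]
    by (intro prod_eqI ext) (simp_all add: brK_Pair ** *[OF A, of v w] *[OF B, of w u] *[OF C, of u v]
        vec_anti[of v "A w"] vec_anti[of w "B u"] vec_anti[of u "C v"]
        A.add A.diff B.add B.diff C.add C.diff)
qed

end

section \<open>The standard grading\<close>

context SP_graded_kantor_pair
begin

section \<open>The grading of the column vectors\<close>

lemma vec_zero_Pair [simp]: "vec (0, 0) w = 0" "vec v (0, 0) = 0"
  using vec_zero by (simp_all only: zero_prod_def)

text \<open>\<open>P\<^sub>i\<^sup>\<sigma>\<close> has degree \<open>(\<sigma>, \<sigma>i)\<close>, whence the sign in front of the index of \<open>Pm\<close>.\<close>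

definition vec_deg :: "int \<times> int \<Rightarrow> ('m \<times> 'p) set" where
  "vec_deg d = (if fst d = 1 then {0} \<times> Pp (snd d)
    else if fst d = -1 then Pm (- snd d) \<times> {0} else {0})"

definition vec_brackets :: "int \<times> int \<Rightarrow> int \<times> int \<Rightarrow> ('m \<times> 'p \<Rightarrow> 'm \<times> 'p) set" where
  "vec_brackets a b = {vec v w | v w. v \<in> vec_deg a \<and> w \<in> vec_deg b}"

text \<open>Degrees are prescribed on generators instead of being read off from the effect on
  vectors. Spanning and the bracket formulas are then close at hand, and the effect on vectors
  becomes a consequence that yields independence.\<close>

definition op_deg :: "int \<times> int \<Rightarrow> ('m \<times> 'p \<Rightarrow> 'm \<times> 'p) set" where
  "op_deg d = E.span (\<Union>a. vec_brackets a (d - a))"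

text \<open>Both factors are kept to avoid a case distinction: the vectors vanish for even
  \<open>i\<close> and the operators for odd \<open>i\<close>.\<close>

definition kantor_deg :: "int \<Rightarrow> int \<Rightarrow> ('m, 'p) kantor_elem set" where
  "kantor_deg i j = op_deg (i, j) \<times> vec_deg (i, j)"

text \<open>These are the short roots of the root system of type BC_2. The remaining roots and 0 are
  exactly the sums of two of them.\<close>

abbreviation "vec_degrees \<equiv> {(1, 0), (1, 1), (-1, 0), (-1, -1)} :: (int \<times> int) set"

lemma subspace_Pm: "neg.subspace (Pm i)" and subspace_Pp: "pos.subspace (Pp i)"
  using direct_sum_neg direct_sum_pos by (simp_all add: internal_direct_sum_def)

lemma subspace_vec_deg: "VP.p.subspace (vec_deg d)"
  by (simp add: vec_deg_def VP.subspace_Times subspace_Pm subspace_Pp)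

lemma vec_deg_support: "a \<notin> vec_degrees \<Longrightarrow> vec_deg a = {0}"
  using support_neg[of "- snd a"] support_pos[of "snd a"] by (cases a) (auto simp: vec_deg_def zero_prod_def)

lemma vec_deg_cases:
  assumes "v \<in> vec_deg a"
  obtains "v = 0" | y where "fst a = 1" "y \<in> Pp (snd a)" "v = (0, y)"
    | x where "fst a = -1" "x \<in> Pm (- snd a)" "v = (x, 0)"
  using assms by (auto simp: vec_deg_def split: if_splits)

lemma vec_deg_pos_hom: "module_hom sp sV (\<lambda>y. (0, y))"
  by unfold_locales (simp_all add: VP.scale_prod)

lemma vec_deg_neg_hom: "module_hom sm sV (\<lambda>x. (x, 0))"
  by unfold_locales (simp_all add: VP.scale_prod)

text \<open>The first coordinate stays fixed at 1 because the first component grading needs each of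
  the two halves separately.\<close>

lemma vec_deg_pos_span: "(0, y) \<in> VP.p.span (\<Union>j. vec_deg (1, j))"
proof -
  have "(0, y) \<in> (\<lambda>y. (0, y)) ` pos.span (\<Union>j. Pp j)"
    using internal_direct_sum_span[OF pos.module_axioms direct_sum_pos] by simp
  also have "\<dots> = VP.p.span (\<Union>j. vec_deg (1, j))"
    unfolding module_hom.span_image[OF vec_deg_pos_hom, symmetric]
    by (rule arg_cong[where f = VP.p.span]) (auto simp: vec_deg_def)
  finally show ?thesis .
qed

lemma vec_deg_neg_span: "(x, 0) \<in> VP.p.span (\<Union>j. vec_deg (-1, j))"
proof -
  have "(x, 0) \<in> (\<lambda>x. (x, 0)) ` neg.span (\<Union>j. Pm j)"
    using internal_direct_sum_span[OF neg.module_axioms direct_sum_neg] by simp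
  also have "\<dots> = VP.p.span (\<Union>j. vec_deg (-1, j))"
    unfolding module_hom.span_image[OF vec_deg_neg_hom, symmetric]
  proof (rule arg_cong[where f = VP.p.span], intro equalityI subsetI)
    fix v :: "'m \<times> 'p" assume "v \<in> (\<lambda>x. (x, 0)) ` (\<Union>j. Pm j)"
    then obtain x j where "v = (x, 0)" "x \<in> Pm j" by blast
    then show "v \<in> (\<Union>j. vec_deg (-1, j))"
      by (intro UN_I[of "- j"]) (simp_all add: vec_deg_def)
  qed (auto simp: vec_deg_def)
  finally show ?thesis .
qed

lemma vec_deg_span: "v \<in> VP.p.span (\<Union>d. vec_deg d)"
proof -
  have "v = (fst v, 0) + (0, snd v)" by simp
  also have "\<dots> \<in> VP.p.span (\<Union>d. vec_deg d)"
    using vec_deg_neg_span[of "fst v"] vec_deg_pos_span[of "snd v"]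
      VP.p.span_mono[of "\<Union>j. vec_deg (1, j)" "\<Union>d. vec_deg d"] VP.p.span_mono[of "\<Union>j. vec_deg (-1, j)" "\<Union>d. vec_deg d"]
    by (intro VP.p.span_add) blast+
  finally show ?thesis .
qed

text \<open>The two coordinate projections separate the first coordinates 1 and -1; within each of
  them the decomposition of the Kantor pair is direct.\<close>

lemma vec_deg_direct_sum: "internal_direct_sum sV UNIV vec_deg"
proof (rule internal_direct_sumI)
  fix J and g :: "int \<times> int \<Rightarrow> 'm \<times> 'p" and d
  assume J: "finite J" "\<And>d. d \<in> J \<Longrightarrow> g d \<in> vec_deg d" "sum g J = 0" "d \<in> J"
  obtain e k where d: "d = (e, k)" by (cases d)
  consider "e = 1" | "e = -1" | "e \<noteq> 1" "e \<noteq> -1" by blast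
  then show "g d = 0"
  proof cases
    case 1
    define h where "h j = (if (1, j) \<in> J then snd (g (1, j)) else 0)" for j
    have h: "h j \<in> Pp j" for j
      using J(2)[of "(1, j)"] subspace_Pp by (auto simp: h_def vec_deg_def pos.subspace_0)
    have "0 = (\<Sum>a\<in>J. snd (g a))"
      using J(3) by (metis snd_sum snd_zero)
    also have "\<dots> = (\<Sum>a\<in>{a \<in> J. fst a = 1}. snd (g a))"
      by (rule sum.mono_neutral_right) (use J in \<open>fastforce simp: vec_deg_def split: if_splits\<close>)+
    also have "\<dots> = sum h {j. (1, j) \<in> J}"
      by (rule sum.reindex_cong[of "Pair 1"]) (auto simp: inj_on_def h_def image_iff)
    finally have "sum h {j. (1, j) \<in> J} = 0" by simp
    moreover have "finite {j. (1, j) \<in> J}"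
      using finite_vimageI[OF J(1), of "Pair 1"] by (simp add: vimage_def inj_on_def)
    ultimately have "h k = 0"
      using internal_direct_sum_imp_0[OF pos.module_axioms direct_sum_pos, of "{j. (1, j) \<in> J}" h k] h
        J(4) d 1 by auto
    then show ?thesis
      using J(2)[OF J(4)] J(4) by (auto simp: d 1 h_def vec_deg_def zero_prod_def)
  next
    case 2
    \<comment> \<open>The sign is flipped because the component of index \<open>j\<close> of the
      negative module has degree \<open>(-1, - j)\<close>.\<close>
    define h where "h j = (if (-1, - j) \<in> J then fst (g (-1, - j)) else 0)" for j
    have h: "h j \<in> Pm j" for j
      using J(2)[of "(-1, - j)"] subspace_Pm by (auto simp: h_def vec_deg_def neg.subspace_0)
    have "0 = (\<Sum>a\<in>J. fst (g a))"
      using J(3) by (metis fst_sum fst_zero)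
    also have "\<dots> = (\<Sum>a\<in>{a \<in> J. fst a = -1}. fst (g a))"
      by (rule sum.mono_neutral_right) (use J in \<open>fastforce simp: vec_deg_def split: if_splits\<close>)+
    also have "\<dots> = sum h {j. (-1, - j) \<in> J}"
    proof (rule sum.reindex_cong[of "\<lambda>j. (-1, -j)"])
      show "{a \<in> J. fst a = -1} = (\<lambda>j. (-1, - j)) ` {j. (-1, - j) \<in> J}"
      proof (intro equalityI subsetI)
        fix a assume "a \<in> {a \<in> J. fst a = -1}"
        then show "a \<in> (\<lambda>j. (-1, - j)) ` {j. (-1, - j) \<in> J}"
          by (cases a) (auto intro!: image_eqI[of _ _ "- snd a"])
      qed auto
    qed (auto simp: inj_on_def h_def)
    finally have "sum h {j. (-1, - j) \<in> J} = 0" by simp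
    moreover have "finite {j. (-1, - j) \<in> J}"
      using finite_vimageI[OF J(1), of "\<lambda>j. (-1, - j)"] by (simp add: vimage_def inj_on_def)
    ultimately have "h (- k) = 0"
      using internal_direct_sum_imp_0[OF neg.module_axioms direct_sum_neg, of "{j. (-1, - j) \<in> J}" h "- k"] h
        J(4) d 2 by auto
    then show ?thesis
      using J(2)[OF J(4)] J(4) by (auto simp: d 2 h_def vec_deg_def zero_prod_def)
  next
    case 3
    then show ?thesis
      using J(2)[OF J(4)] by (simp add: d vec_deg_def)
  qed
qed (use vec_deg_span in \<open>auto simp: subspace_vec_deg VP.p.module_axioms\<close>)

text \<open>With the sign convention for \<open>Pm\<close>, the index \<open>i - j + k\<close> of a
  product becomes the sum of the degrees. Both terms of a \<open>K\<close> land in one component, as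
  that index is symmetric in \<open>i\<close> and \<open>k\<close>.\<close>

lemma vec_deg_vec:
  assumes "u \<in> vec_deg a" "v \<in> vec_deg b" "w \<in> vec_deg c"
  shows "vec u v w \<in> vec_deg (a + b + c)"
proof -
  have [simp]: "0 \<in> vec_deg d" for d
    using subspace_vec_deg by (rule VP.p.subspace_0)
  have [simp]: "(0, 0) \<in> vec_deg d" for d
    using \<open>0 \<in> vec_deg d\<close> by (simp add: zero_prod_def)
  show ?thesis
    using assms(1)
  proof (cases rule: vec_deg_cases)
    case u: (2 y)
    show ?thesis
      using assms(2)
    proof (cases rule: vec_deg_cases)
      case v: (2 z)
      show ?thesis
        using assms(3)
      proof (cases rule: vec_deg_cases)
        case w: (3 x)
        show ?thesis
          using u v w graded_pos[of y "snd a" x "- snd c" z "snd b"]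
            graded_pos[of z "snd b" x "- snd c" y "snd a"]
          by (simp add: vec_blocks kp_def vec_deg_def pos.subspace_diff subspace_Pp algebra_simps)
      qed (use u v in \<open>simp_all add: vec_blocks kp_def\<close>)
    next
      case v: (3 z)
      show ?thesis
        using assms(3)
      proof (cases rule: vec_deg_cases)
        case w: (2 x)
        show ?thesis
          using u v w graded_pos[of y "snd a" z "- snd b" x "snd c"]
          by (simp add: vec_blocks vec_deg_def)
      next
        case w: (3 x)
        have "- tm z y x \<in> Pm (- snd (a + b + c))"
          by (rule back_subst[of "\<lambda>i. - tm z y x \<in> Pm i",
                OF neg.subspace_neg[OF subspace_Pm graded_neg[OF v(2) u(2) w(2)]]]) simp
        then show ?thesis
          using u v w by (simp add: vec_blocks vec_deg_def)
      qed simp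
    qed simp
  next
    case u: (3 y)
    show ?thesis
      using assms(2)
    proof (cases rule: vec_deg_cases)
      case v: (3 z)
      show ?thesis
        using assms(3)
      proof (cases rule: vec_deg_cases)
        case w: (2 x)
        show ?thesis
          using u v w graded_neg[of y "- snd a" x "snd c" z "- snd b"]
            graded_neg[of z "- snd b" x "snd c" y "- snd a"]
          by (simp add: vec_blocks km_def vec_deg_def neg.subspace_diff subspace_Pm algebra_simps)
      qed (use u v in \<open>simp_all add: vec_blocks km_def\<close>)
    next
      case v: (2 z)
      show ?thesis
        using assms(3)
      proof (cases rule: vec_deg_cases)
        case w: (3 x)
        show ?thesis
          using u v w graded_neg[of y "- snd a" z "snd b" x "- snd c"]
          by (simp add: vec_blocks vec_deg_def algebra_simps)
      next
        case w: (2 x)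
        show ?thesis
          using u v w pos.subspace_neg[OF subspace_Pp graded_pos[of z "snd b" y "- snd a" x "snd c"]]
          by (simp add: vec_blocks vec_deg_def algebra_simps)
      qed simp
    qed simp
  qed simp
qed

section \<open>Homogeneous operators\<close>

lemma subspace_op_deg: "E.subspace (op_deg d)"
  by (simp add: op_deg_def)

lemma vec_in_vec_brackets: "v \<in> vec_deg a \<Longrightarrow> w \<in> vec_deg b \<Longrightarrow> vec v w \<in> vec_brackets a b"
  unfolding vec_brackets_def by blast

lemma vec_in_op_deg: "v \<in> vec_deg a \<Longrightarrow> w \<in> vec_deg b \<Longrightarrow> vec v w \<in> op_deg (a + b)"
  unfolding op_deg_def by (intro E.span_base UN_I[of a]) (simp_all add: vec_in_vec_brackets)

lemma op_deg_subset: "op_deg d \<subseteq> SS"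
  unfolding op_deg_def by (rule E.span_minimal) (auto simp: vec_brackets_def vec_in_S subspace_S)

lemma op_deg_apply:
  assumes "A \<in> op_deg d" "v \<in> vec_deg c"
  shows "A v \<in> vec_deg (d + c)"
  using assms(1) unfolding op_deg_def
proof (induction rule: E.span_induct)
  have "module_hom sE sV (\<lambda>A. A v)"
    by unfold_locales simp_all
  from module_hom.subspace_linear_preimage[OF this subspace_vec_deg]
  show "E.subspace (Collect (\<lambda>A. A v \<in> vec_deg (d + c)))" .
next
  fix A assume "A \<in> (\<Union>a. vec_brackets a (d - a))"
  then obtain a p q where "A = vec p q" "p \<in> vec_deg a" "q \<in> vec_deg (d - a)"
    by (auto simp: vec_brackets_def)
  then show "A v \<in> vec_deg (d + c)"
    using vec_deg_vec[of p a q "d - a" v c] assms(2) by simp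
qed

text \<open>By the derivation property, commuting with \<open>A\<close> moves one entry of a bracket
  by \<open>d\<close>, and the total degree is the same whichever entry is moved.\<close>

lemma op_deg_commutator:
  assumes A: "A \<in> op_deg d" and B: "B \<in> op_deg e"
  shows "(A \<circ> B) - (B \<circ> A) \<in> op_deg (d + e)"
proof (rule commutator_span)
  have "A \<in> SS"
    using A op_deg_subset by blast
  then show "module_hom sV sV A"
    by (rule S_linear)
  show "B \<in> E.span (\<Union>a. vec_brackets a (e - a))"
    using assms by (simp add: op_deg_def)
  fix C assume "C \<in> (\<Union>a. vec_brackets a (e - a))"
  then obtain a p q where C: "C = vec p q" "p \<in> vec_deg a" "q \<in> vec_deg (e - a)"
    by (auto simp: vec_brackets_def)
  have "d + a + (e - a) = d + e" "a + (d + (e - a)) = d + e"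
    by simp_all
  then show "(A \<circ> C) - (C \<circ> A) \<in> op_deg (d + e)"
    using vec_in_op_deg[OF op_deg_apply[OF A C(2)] C(3)] vec_in_op_deg[OF C(2) op_deg_apply[OF A C(3)]]
    unfolding C(1) S_vec[OF \<open>A \<in> SS\<close>] by (simp add: E.subspace_add subspace_op_deg)
qed (rule subspace_op_deg)

text \<open>Pairs with a degree outside \<open>vec_degrees\<close> contribute only 0, and by
  antisymmetry one order of each pair is enough. Each component is thereby given by a short list
  \<open>I\<close> of pairs, and completeness of the list is integer arithmetic.\<close>

lemma op_deg_eq_span_vec_brackets:
  assumes ab: "\<And>a b. (a, b) \<in> I \<Longrightarrow> a + b = d"
    and I: "\<And>a b. a \<in> vec_degrees \<Longrightarrow> b \<in> vec_degrees \<Longrightarrow> a + b = d \<Longrightarrow> (a, b) \<in> I \<or> (b, a) \<in> I"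
  shows "op_deg d = E.span (\<Union>(a, b)\<in>I. vec_brackets a b)"
  unfolding op_deg_def E.span_eq
proof (intro conjI subsetI)
  fix A assume "A \<in> (\<Union>a. vec_brackets a (d - a))"
  then obtain a v w where A: "A = vec v w" and v: "v \<in> vec_deg a" and w: "w \<in> vec_deg (d - a)"
    by (auto simp: vec_brackets_def)
  show "A \<in> E.span (\<Union>(a, b)\<in>I. vec_brackets a b)"
  proof (cases "a \<in> vec_degrees \<and> d - a \<in> vec_degrees")
    case True
    then consider "(a, d - a) \<in> I" | "(d - a, a) \<in> I"
      using I[of a "d - a"] by auto
    then show ?thesis
    proof cases
      case 1
      then show ?thesis
        using vec_in_vec_brackets[OF v w] unfolding A
        by (intro E.span_base UN_I[of "(a, d - a)"]) simp_all
    next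
      case 2
      then show ?thesis
        using vec_in_vec_brackets[OF w v] unfolding A vec_anti[of v w]
        by (intro E.span_neg E.span_base UN_I[of "(d - a, a)"]) simp_all
    qed
  next
    case False
    then have "v = 0 \<or> w = 0"
      using v w vec_deg_support by blast
    then show ?thesis
      unfolding A by (auto simp: E.span_zero)
  qed
next
  fix A assume "A \<in> (\<Union>(a, b)\<in>I. vec_brackets a b)"
  then obtain a b where I: "(a, b) \<in> I" and A: "A \<in> vec_brackets a b"
    by blast
  have "b = d - a"
    using ab[OF I] by auto
  then show "A \<in> E.span (\<Union>a. vec_brackets a (d - a))"
    using A by (intro E.span_base UN_I[of a]) simp_all
qed

lemma op_deg_support:
  assumes "\<And>a b. a \<in> vec_degrees \<Longrightarrow> b \<in> vec_degrees \<Longrightarrow> a + b \<noteq> d"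
  shows "op_deg d = {0}"
  using op_deg_eq_span_vec_brackets[of "{}" d] assms by simp

lemma op_deg_direct_sum: "internal_direct_sum sE SS op_deg"
proof (rule internal_direct_sumI)
  show "SS \<subseteq> E.span (\<Union>d. op_deg d)"
    unfolding kantor_S_eq
  proof (rule E.span_minimal)
    show "{vec v w |v w. True} \<subseteq> E.span (\<Union>d. op_deg d)"
    proof clarify
      fix v w
      obtain f J where f: "\<And>i. f i \<in> vec_deg i" "v = sum f J"
        using internal_direct_sum_decomp[OF vec_deg_direct_sum UNIV_I] by metis
      obtain g K where g: "\<And>i. g i \<in> vec_deg i" "w = sum g K"
        using internal_direct_sum_decomp[OF vec_deg_direct_sum UNIV_I] by metis
      have "vec v w = (\<Sum>a\<in>J. \<Sum>b\<in>K. vec (f a) (g b))"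
        unfolding f(2) g(2) module_hom.sum[OF vec_hom_left] module_hom.sum[OF vec_hom_right]
        by (rule sum.swap)
      also have "\<dots> \<in> E.span (\<Union>d. op_deg d)"
        using vec_in_op_deg[OF f(1) g(1)] by (intro E.span_sum E.span_base) blast
      finally show "vec v w \<in> E.span (\<Union>d. op_deg d)" .
    qed
  qed simp
next
  fix J and g :: "int \<times> int \<Rightarrow> 'm \<times> 'p \<Rightarrow> 'm \<times> 'p" and d
  assume J: "finite J" "\<And>d. d \<in> J \<Longrightarrow> g d \<in> op_deg d" "sum g J = 0" "d \<in> J"
  interpret gd: module_hom sV sV "g d"
    using J op_deg_subset by (intro S_linear) blast
  have 0: "g d v = 0" if v: "v \<in> vec_deg c" for v c
  proof -
    \<comment> \<open>Evaluated at \<open>v\<close>, the vanishing sum has terms in the distinct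
      degrees \<open>d + c\<close>. Reindexing along this shift brings it into the form required by
      the direct sum of vectors.\<close>
    have inj: "inj_on (\<lambda>d. d + c) J" by (simp add: inj_on_def)
    have "sum g J v = (\<Sum>d\<in>J. g d v)"
      using J(1) by (induction J) auto
    then have "(\<Sum>d\<in>J. g d v) = 0"
      using J(3) by simp
    then have "(\<Sum>e\<in>(\<lambda>d. d + c) ` J. g (e - c) v) = 0"
      by (simp add: sum.reindex[OF inj])
    moreover have "g e v \<in> vec_deg (e + c)" if "e \<in> J" for e
      using op_deg_apply[OF J(2)[OF that] v] .
    ultimately have "g (d + c - c) v = 0"
      using J by (intro internal_direct_sum_imp_0[OF VP.p.module_axioms vec_deg_direct_sum,
        of "(\<lambda>d. d + c) ` J" "\<lambda>e. g (e - c) v" "d + c"]) auto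
    then show ?thesis by simp
  qed
  have "g d v = 0" for v
    using vec_deg_span[of v] by (rule gd.eq_0_on_span[rotated]) (use 0 in auto)
  then show "g d = 0" by (simp add: fun_eq_iff del: split_paired_All)
qed (use op_deg_subset in \<open>simp_all add: E.module_axioms subspace_S subspace_op_deg\<close>)

section \<open>The grading of the Kantor Lie algebra\<close>

lemma kantor_deg_direct_sum: "internal_direct_sum sK KK (\<lambda>(i, j). kantor_deg i j)"
proof -
  have "(\<lambda>(i, j). kantor_deg i j) = (\<lambda>d. op_deg d \<times> vec_deg d)"
    by (auto simp: fun_eq_iff kantor_deg_def)
  then show ?thesis
    using KP.internal_direct_sum_Times[OF op_deg_direct_sum vec_deg_direct_sum]
    by (simp add: sK_eq kantor_algebra_def)
qed

lemma kantor_deg_BC2_graded: "BC2_graded_lie_algebra sK KK brK kantor_deg"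
proof -
  interpret lie_algebra sK KK brK by (rule kantor_lie_algebra)
  show ?thesis
  proof
    show "internal_direct_sum sK KK (\<lambda>(i, j). kantor_deg i j)" by (rule kantor_deg_direct_sum)
  next
    fix x y i j k l assume "x \<in> kantor_deg i j" "y \<in> kantor_deg k l"
    then obtain A v B w where "x = (A, v)" "y = (B, w)"
      and *: "A \<in> op_deg (i, j)" "v \<in> vec_deg (i, j)" "B \<in> op_deg (k, l)" "w \<in> vec_deg (k, l)"
      by (auto simp: kantor_deg_def)
    then show "brK x y \<in> kantor_deg (i + k) (j + l)"
      using op_deg_commutator[OF *(1,3)] vec_in_op_deg[OF *(2,4)] op_deg_apply[OF *(1,4)] op_deg_apply[OF *(3,2)]
      by (simp add: brK_Pair kantor_deg_def E.subspace_add subspace_op_deg VP.p.subspace_diff subspace_vec_deg add.commute)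
  next
    fix i j assume "(i, j) \<notin> BC2_roots \<union> {(0, 0)}"
    moreover have "vec_degrees \<subseteq> BC2_roots" "a \<in> vec_degrees \<Longrightarrow> b \<in> vec_degrees \<Longrightarrow> a + b \<in> BC2_roots \<union> {(0, 0)}" for a b
      by (auto simp: BC2_roots_def)
    ultimately have "op_deg (i, j) = {0}" "vec_deg (i, j) = {0}"
      by (metis op_deg_support, metis vec_deg_support UnI1 subsetD)
    then show "kantor_deg i j = {0}" by (simp add: kantor_deg_def zero_prod_def)
  qed
qed

lemma kantor_component_eq:
  assumes "\<sigma> \<in> {-1, 1}"
  shows "kantor_component Pm Pp \<sigma> i = Pair 0 ` vec_deg (\<sigma>, \<sigma> * i)"
  using assms by (auto simp: kantor_component_def vec_deg_def kantor_pos_def kantor_neg_def)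

lemma kantor_deg_standard: "standard_BC2_grading sm sp tm tp Pm Pp kantor_deg"
  unfolding standard_BC2_grading_def
proof (intro conjI kantor_deg_BC2_graded ballI allI)
  fix \<sigma> i :: int assume \<sigma>: "\<sigma> \<in> {-1, 1}"
  then have "op_deg (\<sigma>, \<sigma> * i) = {0}"
    by (intro op_deg_support) auto
  then show "kantor_deg (\<sigma> * 1) (\<sigma> * i) = kantor_component Pm Pp \<sigma> i"
    unfolding kantor_component_eq[OF \<sigma>] by (auto simp: kantor_deg_def)
qed

section \<open>Uniqueness of the grading\<close>

lemma standard_unique:
  assumes "standard_BC2_grading sm sp tm tp Pm Pp G"
  shows "G = kantor_deg"
proof -
  interpret BC2_graded_lie_algebra sK KK brK G
    using assms by (simp add: standard_BC2_grading_def)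
  have G1: "G \<sigma> (\<sigma> * i) = Pair 0 ` vec_deg (\<sigma>, \<sigma> * i)" if "\<sigma> \<in> {-1, 1}" for \<sigma> i
    using assms that unfolding kantor_component_eq[OF that, symmetric] standard_BC2_grading_def by auto
  have sub: "KM.subspace (G i j)" for i j
    using direct_sum by (auto simp: internal_direct_sum_def)
  have v: "(0, v) \<in> G i j" if "v \<in> vec_deg (i, j)" for v i j
  proof (cases "i = 1 \<or> i = -1")
    case True
    \<comment> \<open>Since \<open>i * i = 1\<close>, the index \<open>i * j\<close> is the one
      whose signed version \<open>i * (i * j)\<close> equals \<open>j\<close>.\<close>
    then show ?thesis
      using G1[of i "i * j"] that by auto
  next
    case False
    then have "v = 0" using that by (auto simp: vec_deg_def)
    then show ?thesis
      using KM.subspace_0[OF sub] by (simp add: zero_prod_def)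
  qed
  have A: "(A, 0) \<in> G i j" if "A \<in> op_deg (i, j)" for A i j
    using that unfolding op_deg_def
  proof (induction rule: E.span_induct)
    have "module_hom sE sK (\<lambda>A. (A, 0))"
      by unfold_locales simp_all
    from module_hom.subspace_linear_preimage[OF this sub]
    show "E.subspace (Collect (\<lambda>A. (A, 0) \<in> G i j))" .
  next
    fix A assume "A \<in> (\<Union>a. vec_brackets a ((i, j) - a))"
    then obtain k l p q where "A = vec p q" "p \<in> vec_deg (k, l)" "q \<in> vec_deg (i - k, j - l)"
      by (auto simp: vec_brackets_def)
    then show "(A, 0) \<in> G i j"
      using br_graded[OF v v, of p k l q "i - k" "j - l"] by (simp add: brK_Pair)
  qed
  have "kantor_deg i j \<subseteq> G i j" for i j
    using KM.subspace_add[OF sub A v] by (auto simp: kantor_deg_def)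
  then have "(\<lambda>(i, j). kantor_deg i j) = (\<lambda>(i, j). G i j)"
    by (intro internal_direct_sum_subset_imp_eq[OF KM.module_axioms kantor_deg_direct_sum direct_sum]) auto
  then show ?thesis
    by (simp add: fun_eq_iff)
qed

section \<open>Components as spans of brackets\<close>

lemma span_Pair_0: "KM.span ((\<lambda>A. (A, 0)) ` X) = E.span X \<times> {0}"
proof -
  have "module_hom sE sK (\<lambda>A. (A, 0))"
    by unfold_locales simp_all
  from module_hom.span_image[OF this] show ?thesis by auto
qed

lemma bracket_span_vec_deg:
  "bracket_span sK brK (Pair 0 ` vec_deg a) (Pair 0 ` vec_deg b) = E.span (vec_brackets a b) \<times> {0}"
proof -
  have "{brK x y | x y. x \<in> Pair 0 ` vec_deg a \<and> y \<in> Pair 0 ` vec_deg b} =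
      {brK (0, v) (0, w) | v w. v \<in> vec_deg a \<and> w \<in> vec_deg b}"
    by blast
  also have "\<dots> = {(vec v w, 0) | v w. v \<in> vec_deg a \<and> w \<in> vec_deg b}"
    by (simp add: brK_Pair del: split_paired_Ex)
  also have "\<dots> = (\<lambda>A. (A, 0)) ` vec_brackets a b"
    unfolding vec_brackets_def by blast
  finally show ?thesis
    by (simp add: bracket_span_def span_Pair_0)
qed

lemma kantor_deg_even: "even i \<Longrightarrow> kantor_deg i j = op_deg (i, j) \<times> {0}"
  by (auto simp: kantor_deg_def vec_deg_def)

lemma vec_degrees_iff: "a \<in> vec_degrees \<longleftrightarrow>
    fst a = 1 \<and> (snd a = 0 \<or> snd a = 1) \<or> fst a = -1 \<and> (snd a = 0 \<or> snd a = -1)"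
  by (cases a) auto

lemma kantor_deg_components:
  assumes \<sigma>: "\<sigma> \<in> {-1, 1}"
  defines "P \<equiv> kantor_component Pm Pp" and "br \<equiv> bracket_span sK brK"
  shows "i \<in> {0, 1} \<Longrightarrow> kantor_deg (\<sigma> * 2) (\<sigma> * (2 * i)) = br (P \<sigma> i) (P \<sigma> i)"
    and "kantor_deg (\<sigma> * 2) (\<sigma> * 1) = br (P \<sigma> 0) (P \<sigma> 1)"
    and "kantor_deg 0 (\<sigma> * 1) = br (P \<sigma> 1) (P (- \<sigma>) 0)"
    and "kantor_deg 0 0 = submodule_sum sK {0, 1} (\<lambda>j. br (P \<sigma> j) (P (- \<sigma>) j))"
proof -
  have \<sigma>': "- \<sigma> \<in> {-1, 1}"
    using \<sigma> by auto
  \<comment> \<open>Each formula lists all ways, up to order, of writing its degree as a sum of two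
    short roots. These conversions reduce the check to arithmetic in the coordinates.\<close>
  note pair_conv = insert_iff empty_iff prod_eq_iff fst_conv snd_conv fst_add snd_add
  note P = P_def br_def kantor_component_eq[OF \<sigma>] kantor_component_eq[OF \<sigma>'] bracket_span_vec_deg
  show "kantor_deg (\<sigma> * 2) (\<sigma> * (2 * i)) = br (P \<sigma> i) (P \<sigma> i)" if i: "i \<in> {0, 1}"
  proof -
    have "op_deg (\<sigma> * 2, \<sigma> * (2 * i)) = E.span (\<Union>(a, b)\<in>{((\<sigma>, \<sigma> * i), (\<sigma>, \<sigma> * i))}. vec_brackets a b)"
      using i by (elim insertE emptyE; intro op_deg_eq_span_vec_brackets)
        (insert \<sigma>, simp_all only: vec_degrees_iff pair_conv, presburger+)
    then show ?thesis by (simp add: kantor_deg_even P)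
  qed
  have "op_deg (\<sigma> * 2, \<sigma> * 1) = E.span (\<Union>(a, b)\<in>{((\<sigma>, \<sigma> * 0), (\<sigma>, \<sigma> * 1))}. vec_brackets a b)"
    by (intro op_deg_eq_span_vec_brackets; insert \<sigma>; simp only: vec_degrees_iff pair_conv; presburger)
  then show "kantor_deg (\<sigma> * 2) (\<sigma> * 1) = br (P \<sigma> 0) (P \<sigma> 1)"
    by (simp add: kantor_deg_even P)
  have "op_deg (0, \<sigma> * 1) = E.span (\<Union>(a, b)\<in>{((\<sigma>, \<sigma> * 1), (- \<sigma>, - \<sigma> * 0))}. vec_brackets a b)"
    by (intro op_deg_eq_span_vec_brackets; insert \<sigma>; simp only: vec_degrees_iff pair_conv; presburger)
  then show "kantor_deg 0 (\<sigma> * 1) = br (P \<sigma> 1) (P (- \<sigma>) 0)"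
    by (simp add: kantor_deg_even P)
  let ?X = "\<lambda>j. vec_brackets (\<sigma>, \<sigma> * j) (- \<sigma>, - \<sigma> * j)"
  have "op_deg (0, 0) = E.span (\<Union>(a, b)\<in>{((\<sigma>, \<sigma> * 0), (- \<sigma>, - \<sigma> * 0)), ((\<sigma>, \<sigma> * 1), (- \<sigma>, - \<sigma> * 1))}. vec_brackets a b)"
    by (intro op_deg_eq_span_vec_brackets; insert \<sigma>; simp only: vec_degrees_iff pair_conv; presburger)
  then have "op_deg (0, 0) = E.span (\<Union>j\<in>{0, 1}. ?X j)"
    by simp
  then have "kantor_deg 0 0 = KM.span (\<Union>j\<in>{0, 1}. (\<lambda>A. (A, 0)) ` ?X j)"
    by (simp only: kantor_deg_even even_zero span_Pair_0[symmetric] image_UN)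
  also have "\<dots> = KM.span (\<Union>j\<in>{0, 1}. KM.span ((\<lambda>A. (A, 0)) ` ?X j))"
    unfolding KM.span_eq by (auto intro: KM.span_base KM.span_mono[THEN subsetD, rotated])
  finally show "kantor_deg 0 0 = submodule_sum sK {0, 1} (\<lambda>j. br (P \<sigma> j) (P (- \<sigma>) j))"
    by (simp add: submodule_sum_def P span_Pair_0)
qed

section \<open>Comparison with the standard 5-grading\<close>

lemma subspace_first_component: "KM.subspace (first_component_grading sK kantor_deg i)"
  by (simp add: first_component_grading_def submodule_sum_def)

lemma kantor_deg_first_component: "kantor_deg i j \<subseteq> first_component_grading sK kantor_deg i"
  unfolding first_component_grading_def submodule_sum_def by (rule order_trans[OF _ KM.span_superset]) blast

lemma vec_deg_first_component:
  assumes "v \<in> VP.p.span (\<Union>j. vec_deg (i, j))"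
  shows "(0, v) \<in> first_component_grading sK kantor_deg i"
  using assms
proof (induction rule: VP.p.span_induct)
  have "module_hom sV sK (\<lambda>v. (0, v))"
    by unfold_locales simp_all
  from module_hom.subspace_linear_preimage[OF this subspace_first_component]
  show "VP.p.subspace (Collect (\<lambda>v. (0, v) \<in> first_component_grading sK kantor_deg i))" .
next
  fix v assume "v \<in> (\<Union>j. vec_deg (i, j))"
  then obtain j where "(0, v) \<in> kantor_deg i j"
    by (auto simp: kantor_deg_def E.subspace_0 subspace_op_deg)
  then show "(0, v) \<in> first_component_grading sK kantor_deg i"
    using kantor_deg_first_component by blast
qed

lemma vec_first_component:
  assumes "v \<in> VP.p.span (\<Union>j. vec_deg (i, j))" "w \<in> VP.p.span (\<Union>j. vec_deg (k, j))"
  shows "(vec v w, 0) \<in> first_component_grading sK kantor_deg (i + k)"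
  using assms(1)
proof (induction rule: VP.p.span_induct)
  have "module_hom sV sK (\<lambda>v. (vec v w, 0))"
    by unfold_locales (simp_all add: vec_add vec_scale)
  from module_hom.subspace_linear_preimage[OF this subspace_first_component]
  show "VP.p.subspace (Collect (\<lambda>v. (vec v w, 0) \<in> first_component_grading sK kantor_deg (i + k)))" .
next
  fix v assume v: "v \<in> (\<Union>j. vec_deg (i, j))"
  show "(vec v w, 0) \<in> first_component_grading sK kantor_deg (i + k)"
    using assms(2)
  proof (induction rule: VP.p.span_induct)
    have "module_hom sV sK (\<lambda>w. (vec v w, 0))"
      by unfold_locales (simp_all add: vec_add vec_scale)
    from module_hom.subspace_linear_preimage[OF this subspace_first_component]
    show "VP.p.subspace (Collect (\<lambda>w. (vec v w, 0) \<in> first_component_grading sK kantor_deg (i + k)))" .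
  next
    fix w assume "w \<in> (\<Union>j. vec_deg (k, j))"
    then obtain j l where "v \<in> vec_deg (i, j)" "w \<in> vec_deg (k, l)"
      using v by blast
    then have "(vec v w, 0) \<in> kantor_deg (i + k) (j + l)"
      using vec_in_op_deg[of v "(i, j)" w "(k, l)"] VP.p.subspace_0[OF subspace_vec_deg] by (simp add: kantor_deg_def)
    then show "(vec v w, 0) \<in> first_component_grading sK kantor_deg (i + k)"
      using kantor_deg_first_component by blast
  qed
qed

text \<open>As a projection onto a corner, this turns triangular shape into the linear condition
  \<open>upper_block A = A\<close>.\<close>

definition upper_block :: "('m \<times> 'p \<Rightarrow> 'm \<times> 'p) \<Rightarrow> 'm \<times> 'p \<Rightarrow> 'm \<times> 'p" where
  "upper_block A = (\<lambda>u. (fst (A (0, snd u)), 0))"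

definition lower_block :: "('m \<times> 'p \<Rightarrow> 'm \<times> 'p) \<Rightarrow> 'm \<times> 'p \<Rightarrow> 'm \<times> 'p" where
  "lower_block A = (\<lambda>u. (0, snd (A (fst u, 0))))"

lemma upper_block_hom: "module_hom sE sE upper_block"
  by unfold_locales (simp_all add: upper_block_def fun_eq_iff VP.scale_def)

lemma lower_block_hom: "module_hom sE sE lower_block"
  by unfold_locales (simp_all add: lower_block_def fun_eq_iff VP.scale_def)

lemma upper_block_vec: "upper_block (vec v w) = vec (fst v, 0) (fst w, 0)"
  by (simp add: upper_block_def fun_eq_iff vec_apply kp_def km_def)

lemma lower_block_vec: "lower_block (vec v w) = vec (0, snd v) (0, snd w)"
  by (simp add: lower_block_def fun_eq_iff vec_apply kp_def km_def)

lemma upper_block_iff: "(\<exists>b. A = op_matrix 0 b 0 0) \<longleftrightarrow> upper_block A = A"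
proof
  have "upper_block A = op_matrix 0 (\<lambda>y. fst (A (0, y))) 0 0"
    by (simp add: upper_block_def op_matrix_def fun_eq_iff)
  then show "upper_block A = A \<Longrightarrow> \<exists>b. A = op_matrix 0 b 0 0"
    by metis
qed (auto simp: upper_block_def op_matrix_def fun_eq_iff)

lemma lower_block_iff: "(\<exists>c. A = op_matrix 0 0 c 0) \<longleftrightarrow> lower_block A = A"
proof
  have "lower_block A = op_matrix 0 0 (\<lambda>x. snd (A (x, 0))) 0"
    by (simp add: lower_block_def op_matrix_def fun_eq_iff)
  then show "lower_block A = A \<Longrightarrow> \<exists>c. A = op_matrix 0 0 c 0"
    by metis
qed (auto simp: lower_block_def op_matrix_def fun_eq_iff)

text \<open>Components are spanned by vectors and brackets of vectors, so only these need testing;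
  the second coordinates no longer matter.\<close>

lemma first_component_subset:
  assumes "KM.subspace X" "\<And>j v. v \<in> vec_deg (i, j) \<Longrightarrow> (0, v) \<in> X"
    and "\<And>a b v w. fst a + fst b = i \<Longrightarrow> v \<in> vec_deg a \<Longrightarrow> w \<in> vec_deg b \<Longrightarrow> (vec v w, 0) \<in> X"
  shows "first_component_grading sK kantor_deg i \<subseteq> X"
  unfolding first_component_grading_def submodule_sum_def
proof (rule KM.span_minimal)
  have "(A, 0) \<in> X" if "A \<in> op_deg (i, j)" for A j
    using that unfolding op_deg_def
  proof (induction rule: E.span_induct)
    have "module_hom sE sK (\<lambda>A. (A, 0))"
      by unfold_locales simp_all
    from module_hom.subspace_linear_preimage[OF this assms(1)]
    show "E.subspace (Collect (\<lambda>A. (A, 0) \<in> X))" .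
  next
    fix A assume "A \<in> (\<Union>a. vec_brackets a ((i, j) - a))"
    then obtain a v w where "A = vec v w" "v \<in> vec_deg a" "w \<in> vec_deg ((i, j) - a)"
      by (auto simp: vec_brackets_def)
    then show "(A, 0) \<in> X"
      using assms(3)[of a "(i, j) - a" v w] by simp
  qed
  then have "(A, v) \<in> X" if "A \<in> op_deg (i, j)" "v \<in> vec_deg (i, j)" for A v j
    using KM.subspace_add[OF assms(1), of "(A, 0)" "(0, v)"] assms(2) that by simp
  then show "(\<Union>j. kantor_deg i j) \<subseteq> X"
    by (auto simp: kantor_deg_def)
qed (rule assms(1))

lemma subspace_block:
  assumes "module_hom sE sE f"
  shows "KM.subspace {(A, 0) | A. A \<in> SS \<and> f A = A}"
proof -
  interpret f: module_hom sE sE f by fact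
  have "E.subspace {A. A \<in> SS \<and> f A = A}"
    by (rule E.subspaceI) (auto simp: E.subspace_0 E.subspace_add E.subspace_scale subspace_S f.add f.scale)
  then have "KP.p.subspace ({A. A \<in> SS \<and> f A = A} \<times> {0})"
    by (rule KP.subspace_Times) simp
  moreover have "{A. A \<in> SS \<and> f A = A} \<times> {0 :: 'm \<times> 'p} = {(A, 0) | A. A \<in> SS \<and> f A = A}"
    by auto
  ultimately show ?thesis by (simp only: sK_eq)
qed

text \<open>An operator of corner shape may be presented by generators that have other blocks.
  Projecting the presentation leaves only brackets inside that corner, and the operator itself is
  unchanged because \<open>f\<close> fixes it.\<close>

lemma block_first_component:
  assumes "module_hom sE sE f"
    and "\<And>v w. (f (vec v w), 0) \<in> first_component_grading sK kantor_deg i"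
    and "A \<in> SS"
  shows "(f A, 0) \<in> first_component_grading sK kantor_deg i"
  using assms(3) unfolding kantor_S_eq
proof (induction rule: E.span_induct)
  interpret f: module_hom sE sE f by fact
  have "module_hom sE sK (\<lambda>A. (f A, 0))"
    by unfold_locales (simp_all add: f.add f.scale)
  from module_hom.subspace_linear_preimage[OF this subspace_first_component]
  show "E.subspace (Collect (\<lambda>A. (f A, 0) \<in> first_component_grading sK kantor_deg i))" .
qed (use assms(2) in blast)

lemma first_component: "first_component_grading sK kantor_deg i = kantor_5_grading sm sp tm tp i"
proof -
  let ?F = "first_component_grading sK kantor_deg"
  consider "i = -2" | "i = -1" | "i = 0" | "i = 1" | "i = 2" | "i \<notin> {-2, -1, 0, 1, 2}"
    by blast
  then show ?thesis
  proof cases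
    case 1
    have "?F (-2) \<subseteq> {(A, 0) | A. A \<in> SS \<and> upper_block A = A}"
    proof (rule first_component_subset[OF subspace_block[OF upper_block_hom]])
      fix a b v w assume "fst a + fst b = -2" "v \<in> vec_deg a" "w \<in> vec_deg b"
      then have "vec v w = upper_block (vec v w)"
        by (auto simp: upper_block_vec elim!: vec_deg_cases)
      then show "(vec v w, 0) \<in> {(A, 0) | A. A \<in> SS \<and> upper_block A = A}"
        by (simp add: vec_in_S)
    qed (simp add: vec_deg_def vec_in_S E.subspace_0 subspace_S module_hom.zero[OF upper_block_hom])
    moreover have "(upper_block A, 0) \<in> ?F (-2)" if "A \<in> SS" for A
      using block_first_component[OF upper_block_hom _ that, of "-2"]
        vec_first_component[OF vec_deg_neg_span vec_deg_neg_span] by (simp add: upper_block_vec)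
    ultimately show ?thesis
      unfolding 1 kantor_5_grading_def upper_block_iff by fastforce
  next
    case 5
    have "?F 2 \<subseteq> {(A, 0) | A. A \<in> SS \<and> lower_block A = A}"
    proof (rule first_component_subset[OF subspace_block[OF lower_block_hom]])
      fix a b v w assume "fst a + fst b = 2" "v \<in> vec_deg a" "w \<in> vec_deg b"
      then have "vec v w = lower_block (vec v w)"
        by (auto simp: lower_block_vec elim!: vec_deg_cases)
      then show "(vec v w, 0) \<in> {(A, 0) | A. A \<in> SS \<and> lower_block A = A}"
        by (simp add: vec_in_S)
    qed (simp add: vec_deg_def vec_in_S E.subspace_0 subspace_S module_hom.zero[OF lower_block_hom])
    moreover have "(lower_block A, 0) \<in> ?F 2" if "A \<in> SS" for A
      using block_first_component[OF lower_block_hom _ that, of 2]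
        vec_first_component[OF vec_deg_pos_span vec_deg_pos_span] by (simp add: lower_block_vec)
    ultimately show ?thesis
      unfolding 5 kantor_5_grading_def lower_block_iff by fastforce
  next
    case 2
    have hom: "module_hom sm sK kantor_neg"
      by unfold_locales (simp_all add: kantor_neg_def VP.scale_prod)
    have "?F (-1) \<subseteq> range kantor_neg"
    proof (rule first_component_subset)
      show "KM.subspace (range kantor_neg)"
        using module_hom.subspace_image[OF hom] by simp
      fix a b v w assume "fst a + fst b = -1" "v \<in> vec_deg a" "w \<in> vec_deg b"
      \<comment> \<open>Nonzero vectors have first coordinate 1 or -1, so two of them cannot have
        degrees with an odd sum there.\<close>
      then have "vec v w = 0"
        by (auto elim!: vec_deg_cases)
      then show "(vec v w, 0) \<in> range kantor_neg"
        by (auto simp: kantor_neg_def zero_prod_def intro: range_eqI[of _ _ 0])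
    qed (auto simp: vec_deg_def kantor_neg_def)
    moreover have "kantor_neg x \<in> ?F (-1)" for x
      unfolding kantor_neg_def by (rule vec_deg_first_component[OF vec_deg_neg_span])
    ultimately show ?thesis
      unfolding 2 kantor_5_grading_def by auto
  next
    case 4
    have hom: "module_hom sp sK kantor_pos"
      by unfold_locales (simp_all add: kantor_pos_def VP.scale_prod)
    have "?F 1 \<subseteq> range kantor_pos"
    proof (rule first_component_subset)
      show "KM.subspace (range kantor_pos)"
        using module_hom.subspace_image[OF hom] by simp
      fix a b v w assume "fst a + fst b = 1" "v \<in> vec_deg a" "w \<in> vec_deg b"
      then have "vec v w = 0"
        by (auto elim!: vec_deg_cases)
      then show "(vec v w, 0) \<in> range kantor_pos"
        by (auto simp: kantor_pos_def zero_prod_def intro: range_eqI[of _ _ 0])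
    qed (auto simp: vec_deg_def kantor_pos_def)
    moreover have "kantor_pos x \<in> ?F 1" for x
      unfolding kantor_pos_def by (rule vec_deg_first_component[OF vec_deg_pos_span])
    ultimately show ?thesis
      unfolding 4 kantor_5_grading_def by auto
  next
    case 3
    have D: "op_matrix (kp_D tm x y) 0 0 (- kp_D tp y x) = vec (x, 0) (0, y)" for x y
      by (simp add: fun_eq_iff op_matrix_def kp_D_def vec_blocks)
    have swap: "vec (0, y) (x, 0) = - vec (x, 0) (0, y)" for x y
      by (rule vec_anti)
    let ?X = "{(vec (x, 0) (0, y), 0) | x y. True}"
    have X: "(vec (x, 0) (0, y), 0) \<in> KM.span ?X" for x y
      by (rule KM.span_base) blast
    have "?F 0 \<subseteq> KM.span ?X"
    proof (rule first_component_subset)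
      fix a b v w assume "fst a + fst b = 0" "v \<in> vec_deg a" "w \<in> vec_deg b"
      then consider "vec v w = 0" | x y where "vec v w = vec (x, 0) (0, y)"
        | x y where "vec v w = - vec (x, 0) (0, y)"
        by (auto simp: swap elim!: vec_deg_cases)
      then show "(vec v w, 0) \<in> KM.span ?X"
      proof cases
        case 1
        then show ?thesis using KM.span_zero[of ?X] by (simp add: zero_prod_def)
      next
        case 3
        then show ?thesis using KM.span_neg[OF X] by simp
      next
        case 2
        then show ?thesis by (simp only: X)
      qed
    qed (use KM.span_zero[of ?X] in \<open>simp_all add: vec_deg_def zero_prod_def\<close>)
    moreover have "KM.span ?X \<subseteq> ?F 0"
      using vec_first_component[OF vec_deg_neg_span vec_deg_pos_span]
      by (intro KM.span_minimal subspace_first_component) auto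
    ultimately show ?thesis
      unfolding 3 kantor_5_grading_def D by simp
  next
    case 6
    have "?F i \<subseteq> {0}"
    proof (rule first_component_subset[OF KM.subspace_single_0])
      fix a b v w assume "fst a + fst b = i" "v \<in> vec_deg a" "w \<in> vec_deg b"
      then have "vec v w = 0"
        using 6 by (auto elim!: vec_deg_cases)
      then show "(vec v w, 0) \<in> {0}"
        by (simp add: zero_prod_def)
    qed (use 6 in \<open>auto simp: vec_deg_def zero_prod_def\<close>)
    then show ?thesis
      using KM.subspace_0[OF subspace_first_component] 6 by (auto simp: kantor_5_grading_def)
  qed
qed

section \<open>Tight enveloping\<close>

lemma kantor_deg_tightly_envelops:
  "tightly_envelops_SP_graded_kantor_pair sK KK brK kantor_deg sm sp tm tp Pm Pp kantor_neg kantor_pos"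
proof -
  interpret BC2_graded_lie_algebra sK KK brK kantor_deg by (rule kantor_deg_BC2_graded)
  let ?T = "{kantor_neg x + kantor_pos y | x y. True}"
  have T: "?T = range (Pair 0)"
    by (auto simp: kantor_neg_def kantor_pos_def)
  have GP: "kantor_deg \<sigma> (\<sigma> * i) = kantor_component Pm Pp \<sigma> i" if "\<sigma> \<in> {-1, 1}" for \<sigma> i
    using kantor_deg_standard that unfolding standard_BC2_grading_def by auto
  show ?thesis
  proof
    show "kantor_neg (x + y) = kantor_neg x + kantor_neg y" "kantor_neg (sm c x) = sK c (kantor_neg x)" for x y c
      by (simp_all add: kantor_neg_def VP.scale_prod)
    show "kantor_pos (x + y) = kantor_pos x + kantor_pos y" "kantor_pos (sp c x) = sK c (kantor_pos x)" for x y c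
      by (simp_all add: kantor_pos_def VP.scale_prod)
    show "inj kantor_neg" "inj kantor_pos"
      by (auto simp: inj_def kantor_neg_def kantor_pos_def)
    show "range kantor_neg = first_component_grading sK kantor_deg (- 1)"
      "range kantor_pos = first_component_grading sK kantor_deg 1"
      unfolding first_component by (simp_all add: kantor_5_grading_def)
    show "kantor_neg (tm x y x') = brK (brK (kantor_neg x) (kantor_pos y)) (kantor_neg x')" for x y x'
      by (simp add: kantor_neg_def kantor_pos_def brK_Pair vec_blocks fun_eq_iff flip: zero_prod_def)
    show "kantor_pos (tp y x y') = brK (brK (kantor_pos y) (kantor_neg x)) (kantor_pos y')" for y x y'
      by (simp add: kantor_neg_def kantor_pos_def brK_Pair vec_blocks fun_eq_iff flip: zero_prod_def)
    show "kantor_neg ` Pm i = kantor_deg (- 1) (- i)" "kantor_pos ` Pp i = kantor_deg 1 i" for i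
      using GP[of "-1" i] GP[of 1 i] by (simp_all add: kantor_component_def)
    show "lie_subalgebra sK KK brK hull ?T = KK"
    proof (rule hull_unique)
      show "?T \<subseteq> KK"
        unfolding T using E.subspace_0[OF subspace_S] by (auto simp: kantor_algebra_def)
      show "lie_subalgebra sK KK brK KK"
        using subspace_L br_closed by (auto simp: lie_subalgebra_def)
      fix B assume TB: "?T \<subseteq> B" and B: "lie_subalgebra sK KK brK B"
      then have sub: "KM.subspace B" and br: "x \<in> B \<Longrightarrow> y \<in> B \<Longrightarrow> brK x y \<in> B" for x y
        by (auto simp: lie_subalgebra_def)
      have v: "(0, v) \<in> B" for v
        using TB unfolding T by blast
      have "(A, 0) \<in> B" if "A \<in> SS" for A
        using that unfolding kantor_S_eq
      proof (induction rule: E.span_induct)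
        have "module_hom sE sK (\<lambda>A. (A, 0))"
          by unfold_locales simp_all
        from module_hom.subspace_linear_preimage[OF this sub]
        show "E.subspace (Collect (\<lambda>A. (A, 0) \<in> B))" .
      next
        fix A assume "A \<in> {vec v w | v w. True}"
        then show "(A, 0) \<in> B"
          using br[OF v v] by (auto simp: brK_Pair)
      qed
      then have "(A, v) \<in> B" if "A \<in> SS" for A v
        using KM.subspace_add[OF sub _ v, of "(A, 0)" v] that by simp
      then show "KK \<subseteq> B"
        by (auto simp: kantor_algebra_def)
    qed
    have "bracket_span sK brK ?T ?T \<subseteq> SS \<times> {0}"
      unfolding bracket_span_def T
      by (rule KM.span_minimal)
        (auto simp: brK_Pair vec_in_S sK_eq subspace_S intro!: KP.subspace_Times)
    \<comment> \<open>The bracket of an operator with a vector is its value there, so a central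
      operator vanishes on every vector.\<close>
    moreover have "A = 0" if "(A, 0) \<in> lie_center KK brK" for A
    proof
      fix v
      have "(0, v) \<in> KK"
        using E.subspace_0[OF subspace_S] by (simp add: kantor_algebra_def)
      then have "brK (A, 0) (0, v) = 0"
        using that unfolding lie_center_def by blast
      then have "snd (brK (A, 0) (0, v)) = 0"
        by simp
      then show "A v = 0 v"
        by (simp add: brK_Pair)
    qed
    moreover have "0 \<in> bracket_span sK brK ?T ?T"
      by (simp add: bracket_span_def KM.span_zero)
    moreover have "0 \<in> lie_center KK brK"
    proof -
      have "brK 0 x = 0" if "x \<in> KK" for x
        using br_scale_left[of 0 x 0] that subspace_L by (simp add: KM.subspace_0)
      then show ?thesis
        using subspace_L by (simp add: lie_center_def KM.subspace_0)
    qed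
    ultimately show "lie_center KK brK \<inter> bracket_span sK brK ?T ?T = {0}"
      by (auto simp: zero_prod_def)
  qed
qed

end

theorem proposition4p4p1:
  fixes sm :: "'k::comm_ring_1 \<Rightarrow> 'm::ab_group_add \<Rightarrow> 'm"
    and sp :: "'k \<Rightarrow> 'p::ab_group_add \<Rightarrow> 'p"
    and tm :: "'m \<Rightarrow> 'p \<Rightarrow> 'm \<Rightarrow> 'm"
    and tp :: "'p \<Rightarrow> 'm \<Rightarrow> 'p \<Rightarrow> 'p"
    and Pm :: "int \<Rightarrow> 'm set"
    and Pp :: "int \<Rightarrow> 'p set"
  assumes "(6::'k) dvd 1"
    and "SP_graded_kantor_pair sm sp tm tp Pm Pp"
  shows "(\<exists>!G. standard_BC2_grading sm sp tm tp Pm Pp G) \<and>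
    (\<forall>G. standard_BC2_grading sm sp tm tp Pm Pp G \<longrightarrow>
      (let P = kantor_component Pm Pp;
           br = bracket_span (kantor_scale sm sp) (kantor_bracket tm tp)
       in \<forall>\<sigma>\<in>{-1, 1}.
         (\<forall>i\<in>{0, 1}. G (\<sigma> * 2) (\<sigma> * (2 * i)) = br (P \<sigma> i) (P \<sigma> i)) \<and>
         G (\<sigma> * 2) (\<sigma> * 1) = br (P \<sigma> 0) (P \<sigma> 1) \<and>
         G 0 (\<sigma> * 1) = br (P \<sigma> 1) (P (- \<sigma>) 0) \<and>
         G 0 0 = submodule_sum (kantor_scale sm sp) {0, 1} (\<lambda>j. br (P \<sigma> j) (P (- \<sigma>) j))) \<and>
      (\<forall>i. first_component_grading (kantor_scale sm sp) G i = kantor_5_grading sm sp tm tp i) \<and>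
      tightly_envelops_SP_graded_kantor_pair
        (kantor_scale sm sp) (kantor_algebra sm sp tm tp) (kantor_bracket tm tp) G
        sm sp tm tp Pm Pp kantor_neg kantor_pos)"
proof -
  interpret SP_graded_kantor_pair sm sp tm tp Pm Pp
    by (rule assms(2))
  show ?thesis
    unfolding Let_def
  proof (intro conjI allI impI)
    show "\<exists>!G. standard_BC2_grading sm sp tm tp Pm Pp G"
      using kantor_deg_standard standard_unique by blast
  next
    fix G assume "standard_BC2_grading sm sp tm tp Pm Pp G"
    then have "G = kantor_deg"
      by (rule standard_unique)
    show "\<forall>\<sigma>\<in>{-1, 1}.
        (\<forall>i\<in>{0, 1}. G (\<sigma> * 2) (\<sigma> * (2 * i)) = bracket_span sK brK
          (kantor_component Pm Pp \<sigma> i) (kantor_component Pm Pp \<sigma> i)) \<and>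
        G (\<sigma> * 2) (\<sigma> * 1) = bracket_span sK brK
          (kantor_component Pm Pp \<sigma> 0) (kantor_component Pm Pp \<sigma> 1) \<and>
        G 0 (\<sigma> * 1) = bracket_span sK brK
          (kantor_component Pm Pp \<sigma> 1) (kantor_component Pm Pp (- \<sigma>) 0) \<and>
        G 0 0 = submodule_sum sK {0, 1} (\<lambda>j. bracket_span sK brK
          (kantor_component Pm Pp \<sigma> j) (kantor_component Pm Pp (- \<sigma>) j))"
      unfolding \<open>G = kantor_deg\<close> by (intro ballI conjI kantor_deg_components)
    show "first_component_grading sK G i = kantor_5_grading sm sp tm tp i" for i
      unfolding \<open>G = kantor_deg\<close> by (rule first_component)
    show "tightly_envelops_SP_graded_kantor_pair sK KK brK G sm sp tm tp Pm Pp kantor_neg kantor_pos"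
      unfolding \<open>G = kantor_deg\<close> by (rule kantor_deg_tightly_envelops)
  qed
qed

end
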